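(* Let $p\ge 3$ be a prime and let $G$ be the GGS-group defined by a non-symmetric vector $e=(e_1,\dots,e_{p-1})\in \mathbb{F}_p^{p-1}$. The portrait growth sequence $\{a_n\}_{n=0}^{\infty}$ of $G$ (with respect to the nucleus of $G$) is given by $$a_0=1+2(p-1),\qquad a_n=p\,(x_1+(p-1)y_1)^{p^{n-1}}\quad\text{for } n\ge 1,$$ where $x_1$ and $y_1$ are the numbers of solutions $(n_0,\dots,n_{p-1})\in\mathbb{F}_p^{p}$ of $$((n_0, \dots, n_{p-1})\,C(0,e)) \odot (n_0, \dots, n_{p-1})=(0,\dots,0)$$ with $n_0+\dots+n_{p-1}= 0$ and with $n_0+\dots+n_{p-1}=1$, respectively.
   Context: Let $X=\{1,\dots,d\}$ and let $T$ be the $d$-adic rooted tree whose vertices are the finite words over $X$, with $u$ joined to $ux$ for $x \in X$; words of length $n$ form level $n$. $\operatorname{Aut} T$ is the group of automorphisms of this rooted tree. Every $g\in\operatorname{Aut} T$ is written $g=(g_1,\dots,g_d)\alpha$ with $\alpha\in S_d$ and $g_i\in \operatorname{Aut} T$, meaning $g(iw)=\alpha(i)\,g_i(w)$ for $i\in X$ and every word $w$; $g_i$ is the section of $g$ at $i$. The section $g_u$ at any vertex $u$ is defined by $g(uw)=g(u)g_u(w)$. Products are composed so that $gh$ means first $g$, then $h$, i.e. $(gh)_u=g_u h_{g(u)}$. A group $G\le\operatorname{Aut} T$ is self-similar if all sections of its elements lie in $G$. A self-similar group $G$ is contracting if there is a finite set $\mathcal{M}\subseteq G$ such that for every $g\in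 G$ there is a level $n$ such that all sections of $g$ at vertices at and below level $n$ belong to $\mathcal{M}$. The smallest such $\mathcal{M}$ is the nucleus $\mathcal{N}(G)$. For a contracting group $G$, the nucleus portrait of $g\in G$ is the finite decorated rooted tree defined recursively: if $g\in\mathcal{N}(G)$, it is a single root decorated by $g$; otherwise, with $g=(g_1,\dots,g_d)\alpha$, the root is decorated by $\alpha$ and the portraits of $g_1,\dots,g_d$ are attached at the $d$ vertices of level 1. The depth $d(g)$ is the length of the longest path from the root to a leaf of the portrait (equivalently, the least $n$ such that all sections of $g$ at level $n$ lie in $\mathcal{N}(G)$). The portrait growth sequence of a finitely generated contracting group $G$ is $a_n=|\{g\in G\mid d(g)\le n\}|$, $n\ge 0$. For a prime $p\ge3$ and $e=(e_1,\dots,e_{p-1})\in\mathbb{F}_p^{p-1}$, the GGS-group defined by $e$ is the group of automorphisms of the $p$-adic tree ($d=p$) generated by $a=(1,\dots,1)(1\,2\,\dots\,p)$ and the automorphism $b$ fixing level 1 and defined recursively by $b=(b,a^{e_1},\dots,a^{e_{p-1}})$. For $S=\{a,\dots,a^{p-1},b,\dots,b^{p-1}\}$, the nucleus is $S\cup\{1\}$. The vector $e$ is symmetric if $e_i=e_{p-i}$ for all $i=1,\dots,p-1$, and non-symmetric otherwise. $C(0,e)$ is the circulant $p\times p$ matrix over $\mathbb{F}_p$ with first row $(0,e_1,\dots,e_{p-1})$, each next row being the previous one cyclically shifted one place to the right: $$C(0,e)=\begin{pmatrix} 0 & e_1 & e_2 & \dots & e_{p-1}\\ e_{p-1} & 0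 & e_1 & \dots & e_{p-2}\\ \vdots & \vdots & \vdots & \ddots & \vdots\\ e_1 & e_2 & \dots & e_{p-1} & 0\end{pmatrix}.$$ The symbol $\odot$ denotes the coordinatewise product of vectors. *)

theory Defs
  imports
    "HOL-Algebra.Generated_Groups"
    "Berlekamp_Zassenhaus.Finite_Field"
    "Jordan_Normal_Form.Matrix"
begin

section \<open>Automorphisms of the d-adic rooted tree\<close>

text \<open>A vertex is a word over \<open>{1..d}\<close>, read from the root. A tree automorphism is a function
  on all lists that is the identity off the vertices, so that equality of automorphisms is
  equality of functions.\<close>

type_synonym word = "nat list"

type_synonym tree_map = "word \<Rightarrow> word"

definition words :: "nat \<Rightarrow> word set" where
  "words d = lists {1..d}"

definition tree_edge :: "nat \<Rightarrow> word \<Rightarrow> word \<Rightarrow> bool" where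
  "tree_edge d u v \<longleftrightarrow> (\<exists>x\<in>{1..d}. v = u @ [x] \<or> u = v @ [x])"

definition tree_auts :: "nat \<Rightarrow> tree_map set" where
  "tree_auts d = {g. g permutes words d \<and> g [] = [] \<and>
     (\<forall>u\<in>words d. \<forall>v\<in>words d. tree_edge d (g u) (g v) \<longleftrightarrow> tree_edge d u v)}"

text \<open>In a product of \<open>g\<close> and \<open>h\<close>, \<open>g\<close> acts first.\<close>

definition Aut_tree :: "nat \<Rightarrow> tree_map monoid" where
  "Aut_tree d = \<lparr>carrier = tree_auts d, monoid.mult = (\<lambda>g h. h \<circ> g), one = id\<rparr>"

text \<open>The section at \<open>u\<close> is determined by \<open>g (u @ w) = g u @ section_at d g u w\<close>, where
  \<open>g u\<close> has the length of \<open>u\<close>.\<close>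

definition section_at :: "nat \<Rightarrow> tree_map \<Rightarrow> word \<Rightarrow> tree_map" where
  "section_at d g u = (\<lambda>w. if w \<in> words d then drop (length u) (g (u @ w)) else w)"

definition root_perm :: "tree_map \<Rightarrow> nat \<Rightarrow> nat" where
  "root_perm g = (\<lambda>i. hd (g [i]))"

section \<open>Nucleus, portraits and portrait growth\<close>

text \<open>\<open>G\<close> is the carrier of a subgroup of \<open>Aut_tree d\<close>. The minimum in \<open>nucleus\<close> is with respect
  to inclusion; it exists if \<open>G\<close> is contracting.\<close>

definition contracting_set :: "nat \<Rightarrow> tree_map set \<Rightarrow> tree_map set \<Rightarrow> bool" where
  "contracting_set d G M \<longleftrightarrow> finite M \<and> M \<subseteq> G \<and>
     (\<forall>g\<in>G. \<exists>n. \<forall>u\<in>words d. n \<le> length u \<longrightarrow> section_at d g u \<in> M)"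

definition nucleus :: "nat \<Rightarrow> tree_map set \<Rightarrow> tree_map set" where
  "nucleus d G = (LEAST M. contracting_set d G M)"

datatype portrait = Leaf tree_map | Node "nat \<Rightarrow> nat" "portrait list"

inductive is_portrait :: "nat \<Rightarrow> tree_map set \<Rightarrow> tree_map \<Rightarrow> portrait \<Rightarrow> bool"
  for d :: nat and N :: "tree_map set" where
  leaf: "g \<in> N \<Longrightarrow> is_portrait d N g (Leaf g)"
| node: "g \<notin> N \<Longrightarrow>
    list_all2 (is_portrait d N) (map (\<lambda>i. section_at d g [i]) [1..<Suc d]) ps \<Longrightarrow>
    is_portrait d N g (Node (root_perm g) ps)"

text \<open>The recursion defining the portrait terminates for elements of a contracting group; the
  portrait is then the unique tree related to \<open>g\<close>.\<close>

definition nucleus_portrait :: "nat \<Rightarrow> tree_map set \<Rightarrow> tree_map \<Rightarrow> portrait" where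
  "nucleus_portrait d G g = (THE P. is_portrait d (nucleus d G) g P)"

fun height :: "portrait \<Rightarrow> nat" where
  "height (Leaf g) = 0"
| "height (Node \<alpha> ps) = Suc (Max (set (map height ps)))"

definition depth :: "nat \<Rightarrow> tree_map set \<Rightarrow> tree_map \<Rightarrow> nat" where
  "depth d G g = height (nucleus_portrait d G g)"

definition portrait_growth :: "nat \<Rightarrow> tree_map set \<Rightarrow> nat \<Rightarrow> nat" where
  "portrait_growth d G n = card {g \<in> G. depth d G g \<le> n}"

section \<open>GGS-groups\<close>

text \<open>The defining vector is a function of which only the values at \<open>1, \<dots>, p - 1\<close> are used. The
  exponent \<open>e i\<close> of \<open>a\<close> is replaced by its representative in \<open>{0..<p}\<close>.\<close>

definition ggs_a :: "nat \<Rightarrow> tree_map" where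
  "ggs_a p w = (if w \<in> words p \<and> w \<noteq> []
     then (if hd w = p then 1 else Suc (hd w)) # tl w else w)"

text \<open>The last case of \<open>ggs_b\<close> concerns lists that are not vertices.\<close>

fun ggs_b :: "nat \<Rightarrow> (nat \<Rightarrow> 'p::prime_card mod_ring) \<Rightarrow> tree_map" where
  "ggs_b p e [] = []"
| "ggs_b p e (x # w) =
    (if x = 1 then 1 # ggs_b p e w
     else if x \<in> {2..p}
       then x # (ggs_a p [^]\<^bsub>Aut_tree p\<^esub> nat (to_int_mod_ring (e (x - 1)))) w
     else x # w)"

definition GGS :: "nat \<Rightarrow> (nat \<Rightarrow> 'p::prime_card mod_ring) \<Rightarrow> tree_map set" where
  "GGS p e = generate (Aut_tree p) {ggs_a p, ggs_b p e}"

definition symmetric_vector :: "nat \<Rightarrow> (nat \<Rightarrow> 'a) \<Rightarrow> bool" where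
  "symmetric_vector p e \<longleftrightarrow> (\<forall>i\<in>{1..p - 1}. e i = e (p - i))"

section \<open>The circulant system\<close>

text \<open>Rows and columns are numbered from \<open>0\<close>; the first row is \<open>c 0, \<dots>, c (n - 1)\<close>, and each next
  row is the previous one shifted cyclically one place to the right.\<close>

definition circulant :: "nat \<Rightarrow> (nat \<Rightarrow> 'a) \<Rightarrow> 'a mat" where
  "circulant n c = mat n n (\<lambda>(i, j). c ((n + j - i) mod n))"

definition C0 :: "nat \<Rightarrow> (nat \<Rightarrow> 'a::zero) \<Rightarrow> 'a mat" where
  "C0 p e = circulant p (\<lambda>k. if k = 0 then 0 else e k)"

definition coord_prod :: "'a::times vec \<Rightarrow> 'a vec \<Rightarrow> 'a vec" (infixl "\<odot>\<^sub>v" 70) where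
  "u \<odot>\<^sub>v v = vec (dim_vec v) (\<lambda>i. u $ i * v $ i)"

text \<open>The row vector \<open>v C\<close> is rendered as \<open>C\<^sup>T v\<close>.\<close>

definition solutions :: "nat \<Rightarrow> (nat \<Rightarrow> 'a::comm_semiring_0) \<Rightarrow> 'a \<Rightarrow> 'a vec set" where
  "solutions p e s = {v \<in> carrier_vec p.
     (transpose_mat (C0 p e) *\<^sub>v v) \<odot>\<^sub>v v = 0\<^sub>v p \<and> (\<Sum>i<p. v $ i) = s}"

end

(*
  Every automorphism in G acts at each vertex by a power of the cycle, so elements are encoded by
  their rotation amounts, with F_p as index set of the letters. The elements a^s b^t form a system
  of representatives of G modulo G', and rot and b_exp are the exponents of a and b. For g in G, the
  a-exponents of the first-level sections are the convolution of their b-exponents with e.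
  Conversely, a tuple from G with this property is the tuple of sections of an element of the level
  stabiliser, because G' x 1 x ... x 1 consists of section tuples if e is non-symmetric.
  For n >= 1, "depth <= n" does not change under multiplication by powers of a, so the elements of the
  stabiliser of depth <= n + 1 correspond to arbitrary p-tuples of those of depth <= n. For
  depth <= 1 all sections lie in the nucleus, that is, for each of them one of the two exponents
  vanishes, which is the circulant system.

  For the inclusion of G' x 1 x ... x 1, choose i with e_{-i} <> 0 and e_i <> e_{-i}, and suppose that
  e_i <> 0 (otherwise [b, b^(a^i)] already has a single non-trivial section). Commutators of conjugates of b give pairs (u, v) such that (u at 0, v^{-1} at i) is a
  section tuple. Read modulo R = {u. (u, 1, ..., 1) is a section tuple}, the relation v = phi(u) takes
  conjugation by b^s to conjugation by a^{s e_i}, and conjugation by a^{s e_{-i}} to conjugation by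
  b^s. So phi^2 takes conjugation by a to conjugation by a^t with t = e_i / e_{-i}. As phi^p = 1 and
  t^p = t <> 1, a centralises G' modulo R, and hence so does b. Finally phi multiplies [b, a] by t,
  and phi^p = 1 forces [b, a] into R.
*)

theory Submission
  imports Defs "HOL-Library.FuncSet"
begin

section \<open>Tree automorphisms that act by rotations\<close>

text \<open>\<open>lab g w\<close> is the amount by which the section of \<open>g\<close> at the vertex \<open>w\<close> rotates the letters.
  The group is written additively, and \<open>g + h\<close> means first \<open>g\<close>, then \<open>h\<close>.\<close>

datatype 'k raut = Raut (lab: "'k list \<Rightarrow> 'k")

definition rot :: "'k raut \<Rightarrow> 'k" where
  "rot g = lab g []"

definition sec :: "'k \<Rightarrow> 'k raut \<Rightarrow> 'k raut" where
  "sec k g = Raut (\<lambda>w. lab g (k # w))"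

definition mk :: "'k \<Rightarrow> ('k \<Rightarrow> 'k raut) \<Rightarrow> 'k raut" where
  "mk s f = Raut (\<lambda>w. case w of [] \<Rightarrow> s | k # v \<Rightarrow> lab (f k) v)"

lemma rot_mk [simp]: "rot (mk s f) = s"
  and sec_mk [simp]: "sec k (mk s f) = f k"
  by (simp_all add: rot_def sec_def mk_def)

lemma lab_Nil: "lab g [] = rot g"
  and lab_Cons: "lab g (k # w) = lab (sec k g) w"
  by (simp_all add: rot_def sec_def)

lemma raut_eqI:
  assumes "rot g = rot h" "\<And>k. sec k g = sec k h"
  shows "g = h"
proof (rule raut.expand, rule ext)
  fix w show "lab g w = lab h w"
    using assms by (cases w) (simp_all add: lab_Nil lab_Cons)
qed

lemma mk_rot_sec [simp]: "mk (rot g) (\<lambda>k. sec k g) = g"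
  by (rule raut_eqI) simp_all

fun act :: "'k::ab_group_add raut \<Rightarrow> 'k list \<Rightarrow> 'k list" where
  "act g [] = []"
| "act g (k # w) = (k + rot g) # act (sec k g) w"

text \<open>The inverse action is spelled out letter by letter because \<open>uminus\<close> has to
  be defined before any group structure is available.\<close>

fun act_inv :: "'k::ab_group_add raut \<Rightarrow> 'k list \<Rightarrow> 'k list" where
  "act_inv g [] = []"
| "act_inv g (k # w) = (k - rot g) # act_inv (sec (k - rot g) g) w"

instantiation raut :: (ab_group_add) group_add
begin

definition zero_raut :: "'a raut" where
  "0 = Raut (\<lambda>_. 0)"

definition plus_raut :: "'a raut \<Rightarrow> 'a raut \<Rightarrow> 'a raut" where
  "g + h = Raut (\<lambda>w. lab g w + lab h (act g w))"

definition uminus_raut :: "'a raut \<Rightarrow> 'a raut" where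
  "- g = Raut (\<lambda>w. - lab g (act_inv g w))"

definition minus_raut :: "'a raut \<Rightarrow> 'a raut \<Rightarrow> 'a raut" where
  "minus_raut g h = g + - h"

text \<open>Wreath recursion for the operations. Each group law then follows by induction on the
  word, with the automorphisms arbitrary.\<close>

lemma rot_zero_raw: "rot (0 :: 'a raut) = 0"
  and sec_zero_raw: "sec k (0 :: 'a raut) = 0"
  and rot_plus_raw: "rot (g + h) = rot g + rot (h :: 'a raut)"
  and sec_plus_raw: "sec k (g + h) = sec k g + sec (k + rot g) (h :: 'a raut)"
  and rot_uminus_raw: "rot (- g) = - rot (g :: 'a raut)"
  and sec_uminus_raw: "sec k (- g) = - sec (k - rot g) (g :: 'a raut)"
  by (simp_all add: rot_def sec_def zero_raut_def plus_raut_def uminus_raut_def)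

lemmas raut_raw = rot_zero_raw sec_zero_raw rot_plus_raw sec_plus_raw rot_uminus_raw sec_uminus_raw

instance
proof
  fix g h k :: "'a raut"
  have "lab (g + h + k) w = lab (g + (h + k)) w" for w
    by (induction w arbitrary: g h k) (simp_all add: lab_Nil lab_Cons raut_raw add.assoc)
  then show "g + h + k = g + (h + k)"
    by (intro raut.expand ext)
  have "lab (0 + g) w = lab g w" for w
    by (induction w arbitrary: g) (simp_all add: lab_Nil lab_Cons raut_raw)
  then show "0 + g = g"
    by (intro raut.expand ext)
  have "lab (g + 0) w = lab g w" for w
    by (induction w arbitrary: g) (simp_all add: lab_Nil lab_Cons raut_raw)
  then show "g + 0 = g"
    by (intro raut.expand ext)
  have "lab (- g + g) w = lab 0 w" for w
    by (induction w arbitrary: g) (simp_all add: lab_Nil lab_Cons raut_raw)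
  then show "- g + g = 0"
    by (intro raut.expand ext)
  show "g + - h = g - h"
    by (simp add: minus_raut_def)
qed

end

lemma rot_zero [simp]: "rot 0 = 0"
  and sec_zero [simp]: "sec k 0 = 0"
  and rot_plus [simp]: "rot (g + h) = rot g + rot h"
  and sec_plus [simp]: "sec k (g + h) = sec k g + sec (k + rot g) h"
  and rot_uminus [simp]: "rot (- g) = - rot g"
  and sec_uminus [simp]: "sec k (- g) = - sec (k - rot g) g"
  by (fact raut_raw)+

lemma rot_diff [simp]: "rot (g - h) = rot g - rot h"
  and sec_diff [simp]: "sec k (g - h) = sec k g - sec (k + rot g - rot h) h"
  unfolding diff_conv_add_uminus[of g h] rot_plus sec_plus rot_uminus sec_uminus by simp_all

section \<open>Powers of the rotation, and conjugation\<close>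

definition apow :: "'k::ab_group_add \<Rightarrow> 'k raut" where
  "apow s = mk s (\<lambda>_. 0)"

lemma rot_apow [simp]: "rot (apow s) = s"
  and sec_apow [simp]: "sec k (apow s) = 0"
  by (simp_all add: apow_def)

lemma apow_0 [simp]: "apow 0 = 0"
  by (rule raut_eqI) simp_all

lemma apow_add: "apow (s + t) = apow s + apow t"
  by (rule raut_eqI) simp_all

lemma apow_uminus: "apow (- s) = - apow s"
  by (rule raut_eqI) simp_all

lemma apow_eq_iff [simp]: "apow s = apow t \<longleftrightarrow> s = t"
  by (metis rot_apow)

text \<open>Used with \<open>simp only\<close>, these rules reduce words in a noncommutative group,
  so that identities valid in free groups close by rewriting.\<close>

lemmas group_norm = add.assoc minus_add diff_conv_add_uminus minus_minus add_minus_cancel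
  minus_add_cancel minus_zero add_0_left add_0_right right_minus left_minus

definition conj_by :: "'g::group_add \<Rightarrow> 'g \<Rightarrow> 'g" where
  "conj_by g u = - g + u + g"

lemma conj_by_0 [simp]: "conj_by 0 u = u"
  and conj_by_zero [simp]: "conj_by g 0 = 0"
  and conj_by_add: "conj_by g (u + v) = conj_by g u + conj_by g v"
  and conj_by_uminus: "conj_by g (- u) = - conj_by g u"
  and conj_by_conj_by: "conj_by h (conj_by g u) = conj_by (g + h) u"
  by (simp_all only: conj_by_def group_norm)

lemma conj_by_diff: "conj_by g (u - v) = conj_by g u - conj_by g v"
  using conj_by_add[of g u "- v"] by (simp add: conj_by_uminus)

section \<open>The group and its section tuples\<close>

text \<open>Indexing by the field turns the index p - i into \<open>- i\<close>. The value
  \<open>0\<close> at \<open>0\<close> is the diagonal of the circulant matrix, and it keeps the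
  index \<open>0\<close> from witnessing non-symmetry.\<close>

locale ggs =
  fixes e :: "'p::prime_card mod_ring \<Rightarrow> 'p mod_ring"
  assumes e_0 [simp]: "e 0 = 0" and nonsym: "\<exists>i. e i \<noteq> e (- i)"
begin

text \<open>The labels of the s-th power of b. As b occurs among its own sections, they are defined
  by recursion on the word instead of by \<open>mk\<close>.\<close>

fun blab :: "'p mod_ring \<Rightarrow> 'p mod_ring list \<Rightarrow> 'p mod_ring" where
  "blab s [] = 0"
| "blab s (k # w) = (if k = 0 then blab s w else lab (apow (s * e k)) w)"

definition bpow :: "'p mod_ring \<Rightarrow> 'p mod_ring raut" where
  "bpow s = Raut (blab s)"

lemma rot_bpow [simp]: "rot (bpow s) = 0"
  and sec_bpow: "sec k (bpow s) = (if k = 0 then bpow s else apow (s * e k))"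
  by (simp_all add: bpow_def rot_def sec_def)

lemma bpow_add: "bpow (s + t) = bpow s + bpow t"
proof -
  have "lab (bpow (s + t)) w = lab (bpow s + bpow t) w" for w
    by (induction w) (simp_all add: lab_Nil lab_Cons sec_bpow distrib_right apow_add)
  then show ?thesis
    by (intro raut.expand ext)
qed

lemma bpow_0 [simp]: "bpow 0 = 0"
  using bpow_add[of 0 0] add_left_imp_eq[of "bpow 0" "bpow 0" 0] by simp

lemma bpow_uminus: "bpow (- s) = - bpow s"
  using bpow_add[of s "- s"] minus_unique[of "bpow s" "bpow (- s)"] by simp

lemma e_nonzero: obtains i where "e i \<noteq> 0" "i \<noteq> 0"
  using nonsym e_0 by (metis)

lemma bpow_eq_iff [simp]: "bpow s = bpow t \<longleftrightarrow> s = t"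
proof
  assume eq: "bpow s = bpow t"
  obtain i where "e i \<noteq> 0" "i \<noteq> 0"
    by (rule e_nonzero)
  with arg_cong[OF eq, of "sec i"] show "s = t"
    by (simp add: sec_bpow)
qed simp

lemma apow_eq_bpow_iff [simp]: "apow s = bpow t \<longleftrightarrow> s = 0 \<and> t = 0"
proof
  assume eq: "apow s = bpow t"
  have "s = 0"
    using arg_cong[OF eq, of rot] by simp
  then have "bpow 0 = bpow t"
    using eq by simp
  then show "s = 0 \<and> t = 0"
    using \<open>s = 0\<close> by (simp only: bpow_eq_iff)
qed simp

definition b_conj :: "'p mod_ring \<Rightarrow> 'p mod_ring \<Rightarrow> 'p mod_ring raut" where
  "b_conj i s = conj_by (apow i) (bpow s)"

lemma rot_b_conj [simp]: "rot (b_conj i s) = 0"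
  and sec_b_conj: "sec k (b_conj i s) = (if k = i then bpow s else apow (s * e (k - i)))"
  by (simp_all add: b_conj_def conj_by_def sec_bpow)

text \<open>All powers of a and b are taken as generators, so closure under inverses is a
  consequence and inductions have three cases.\<close>

inductive_set G :: "'p mod_ring raut set" where
  apow: "apow s \<in> G"
| bpow: "bpow s \<in> G"
| add: "g \<in> G \<Longrightarrow> h \<in> G \<Longrightarrow> g + h \<in> G"

lemma G_0 [simp]: "0 \<in> G"
  using G.apow[of 0] by simp

lemma G_uminus [intro]: "g \<in> G \<Longrightarrow> - g \<in> G"
proof (induction rule: G.induct)
  case (apow s) then show ?case by (metis G.apow apow_uminus)
next
  case (bpow s) then show ?case by (metis G.bpow bpow_uminus)
next
  case (add g h) then show ?case by (simp add: minus_add G.add del: add_uminus_conv_diff)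
qed

lemma G_diff: "g \<in> G \<Longrightarrow> h \<in> G \<Longrightarrow> g - h \<in> G"
  using G.add[OF _ G_uminus, of g h] by simp

lemma G_conj_by: "g \<in> G \<Longrightarrow> u \<in> G \<Longrightarrow> conj_by g u \<in> G"
  by (simp add: conj_by_def G.add G_uminus)

lemma b_conj_in_G: "b_conj i s \<in> G"
  by (simp add: b_conj_def G_conj_by G.apow G.bpow)

lemma sec_in_G: "g \<in> G \<Longrightarrow> sec k g \<in> G"
  by (induction arbitrary: k rule: G.induct) (auto simp: sec_bpow intro: G.intros)

end


section \<open>Section tuples with a single non-trivial entry\<close>

definition only_at :: "'k \<Rightarrow> 'k raut \<Rightarrow> 'k::ab_group_add raut" where
  "only_at k u = mk 0 (\<lambda>j. if j = k then u else 0)"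

lemma rot_only_at [simp]: "rot (only_at k u) = 0"
  and sec_only_at: "sec j (only_at k u) = (if j = k then u else 0)"
  by (simp_all add: only_at_def)

lemma only_at_0 [simp]: "only_at k 0 = 0"
  and only_at_add: "only_at k (u + v) = only_at k u + only_at k v"
  and only_at_uminus: "only_at k (- u) = - only_at k u"
  by (rule raut_eqI; simp add: sec_only_at)+

lemma only_at_diff: "only_at k (u - v) = only_at k u - only_at k v"
  using only_at_add[of k u "- v"] by (simp add: only_at_uminus)

lemma only_at_commute: "k \<noteq> l \<Longrightarrow> only_at k u + only_at l v = only_at l v + only_at k u"
  by (rule raut_eqI) (auto simp: sec_only_at)

lemma conj_by_apow_only_at: "conj_by (apow d) (only_at k u) = only_at (k + d) u"
  by (rule raut_eqI) (auto simp: conj_by_def sec_only_at)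

lemma conj_by_only_at: "rot w = 0 \<Longrightarrow> conj_by w (only_at k u) = only_at k (conj_by (sec k w) u)"
  by (rule raut_eqI) (auto simp: conj_by_def sec_only_at)

context ggs
begin

text \<open>\<open>linked d u v\<close> says that \<open>u\<close> at position \<open>0\<close> and the inverse of \<open>v\<close> at position \<open>d\<close> can be
  realised in \<open>G\<close>. The positions add up under composition, so that \<open>p\<close> steps lead back to
  \<open>linked 0\<close>, which is congruence modulo \<open>{u. only_at 0 u \<in> G}\<close>.\<close>

definition linked :: "'p mod_ring \<Rightarrow> 'p mod_ring raut \<Rightarrow> 'p mod_ring raut \<Rightarrow> bool" where
  "linked d u v \<longleftrightarrow> only_at 0 u - only_at d v \<in> G"

text \<open>Conjugation by \<open>apow d\<close> moves the second pair to the positions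
  \<open>d\<close> and \<open>d + d'\<close>, where the two entries \<open>v\<close> cancel.\<close>

lemma linked_trans:
  assumes "linked d u v" "linked d' v w" shows "linked (d + d') u w"
proof -
  have "only_at 0 u - only_at d v + conj_by (apow d) (only_at 0 v - only_at d' w) \<in> G"
    using assms by (intro G.add G_conj_by G.apow) (simp_all add: linked_def)
  also have "only_at 0 u - only_at d v + conj_by (apow d) (only_at 0 v - only_at d' w)
      = only_at 0 u - only_at (d + d') w"
    by (simp only: conj_by_add conj_by_uminus conj_by_apow_only_at group_norm add.commute[of d'])
  finally show ?thesis by (simp add: linked_def)
qed

lemma linked_sym:
  assumes "linked d u v" shows "linked (- d) v u"
proof -
  have "conj_by (apow (- d)) (- (only_at 0 u - only_at d v)) \<in> G"
    using assms by (intro G_conj_by G_uminus G.apow) (simp_all add: linked_def)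
  also have "conj_by (apow (- d)) (- (only_at 0 u - only_at d v)) = only_at 0 v - only_at (- d) u"
    by (simp add: conj_by_diff conj_by_apow_only_at)
  finally show ?thesis by (simp add: linked_def)
qed

lemma linked_refl [simp]: "linked 0 u u"
  by (simp add: linked_def)

lemma linked_0_sym: "linked 0 u v \<Longrightarrow> linked 0 v u"
  using linked_sym[of 0] by simp

lemma linked_0_trans: "linked 0 u v \<Longrightarrow> linked 0 v w \<Longrightarrow> linked 0 u w"
  using linked_trans[of 0 u v 0 w] by simp

text \<open>An element of the level stabiliser conjugates each entry by its own section there, so
  the two ends may be conjugated differently.\<close>

lemma linked_conj_by:
  assumes "linked d u v" "w \<in> G" "rot w = 0"
  shows "linked d (conj_by (sec 0 w) u) (conj_by (sec d w) v)"
  using G_conj_by[OF assms(2) assms(1)[unfolded linked_def]] assms(3)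
  by (simp add: linked_def conj_by_diff conj_by_only_at)

lemma linked_uminus:
  assumes "linked d u v" "d \<noteq> 0" shows "linked d (- u) (- v)"
proof -
  have "- (only_at 0 u - only_at d v) = only_at 0 (- u) - only_at d (- v)"
    using only_at_commute[of d 0 v "- u"] assms(2) by (simp add: only_at_uminus)
  then show ?thesis
    using G_uminus[OF assms(1)[unfolded linked_def]] by (simp add: linked_def)
qed

text \<open>Entries at distinct positions commute. The order of \<open>v\<close> and
  \<open>v'\<close> is reversed because the entry at \<open>d\<close> is an inverse.\<close>

lemma linked_add:
  assumes "linked d u v" "linked d u' v'" "d \<noteq> 0" shows "linked d (u + u') (v' + v)"
proof -
  have "only_at 0 u - only_at d v + (only_at 0 u' - only_at d v')
      = only_at 0 u + (only_at d (- v) + only_at 0 u') - only_at d v'"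
    by (simp only: only_at_uminus group_norm)
  also have "only_at d (- v) + only_at 0 u' = only_at 0 u' + only_at d (- v)"
    using assms(3) by (rule only_at_commute)
  also have "only_at 0 u + (only_at 0 u' + only_at d (- v)) - only_at d v' = only_at 0 (u + u') - only_at d (v' + v)"
    by (simp only: only_at_uminus only_at_add group_norm)
  finally show ?thesis
    using G.add[OF assms(1,2)[unfolded linked_def]] by (simp add: linked_def)
qed

text \<open>The group is fractal: a conjugate of a power of b has any prescribed power of a as its
  section at \<open>0\<close>, and a power of b has itself there.\<close>

lemma stab_lift:
  assumes "g \<in> G"
  obtains w where "w \<in> G" "rot w = 0" "sec 0 w = g"
proof -
  have "\<exists>w\<in>G. rot w = 0 \<and> sec 0 w = g"
    using assms
  proof (induction rule: G.induct)
    case (apow s)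
    obtain i where i: "e i \<noteq> 0" "i \<noteq> 0" by (rule e_nonzero)
    then have "sec 0 (b_conj (- i) (s / e i)) = apow s"
      by (simp add: sec_b_conj)
    then show ?case using b_conj_in_G rot_b_conj by blast
  next
    case (bpow s)
    show ?case by (rule bexI[of _ "bpow s"]) (simp_all add: sec_bpow G.bpow)
  next
    case (add g h)
    then obtain v w where "v \<in> G" "rot v = 0" "sec 0 v = g" "w \<in> G" "rot w = 0" "sec 0 w = h"
      by blast
    then show ?case by (intro bexI[of _ "v + w"]) (simp_all add: G.add)
  qed
  then show ?thesis using that by blast
qed

lemma linked_0_conj_by:
  assumes "linked 0 u v" "g \<in> G" shows "linked 0 (conj_by g u) (conj_by g v)"
proof -
  obtain w where "w \<in> G" "rot w = 0" "sec 0 w = g"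
    by (rule stab_lift[OF assms(2)])
  then show ?thesis
    using linked_conj_by[OF assms(1), of w] by simp
qed

text \<open>Normality in the form of a congruence: \<open>(u + v) - (u' + v')\<close> is a conjugate
  of \<open>v - v'\<close> by an inverse of \<open>u\<close>, followed by
  \<open>u - u'\<close>.\<close>

lemma linked_0_add:
  assumes "linked 0 u u'" "linked 0 v v'" "u \<in> G" shows "linked 0 (u + v) (u' + v')"
proof -
  have "linked 0 (conj_by (- u) v) (conj_by (- u) v')"
    using assms by (intro linked_0_conj_by G_uminus)
  then have "only_at 0 (conj_by (- u) v - conj_by (- u) v') \<in> G"
    by (simp add: linked_def only_at_diff)
  moreover have "only_at 0 (u - u') \<in> G"
    using assms by (simp add: linked_def only_at_diff)
  ultimately have "only_at 0 (conj_by (- u) v - conj_by (- u) v' + (u - u')) \<in> G"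
    by (simp only: only_at_add G.add)
  also have "conj_by (- u) v - conj_by (- u) v' + (u - u') = (u + v) - (u' + v')"
    by (simp only: conj_by_def group_norm)
  finally show ?thesis by (simp add: linked_def only_at_diff)
qed

lemma linked_0_zero_iff: "linked 0 u 0 \<longleftrightarrow> only_at 0 u \<in> G"
  by (simp add: linked_def)

section \<open>Commutators modulo \<open>linked 0\<close>\<close>

definition comm_ba :: "'p mod_ring \<Rightarrow> 'p mod_ring \<Rightarrow> 'p mod_ring raut" where
  "comm_ba s t = - bpow s - apow t + bpow s + apow t"

lemma comm_ba_0 [simp]: "comm_ba s 0 = 0" "comm_ba 0 t = 0"
  by (simp_all add: comm_ba_def)

lemma comm_ba_in_G: "comm_ba s t \<in> G"
  by (simp add: comm_ba_def G.add G.apow G.bpow G_diff G_uminus)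

lemma comm_ba_add_right: "comm_ba s (t + t') = comm_ba s t' + conj_by (apow t') (comm_ba s t)"
  by (simp only: comm_ba_def conj_by_def apow_add group_norm)

lemma comm_ba_add_left: "comm_ba (s + s') t = conj_by (bpow s') (comm_ba s t) + comm_ba s' t"
  by (simp only: comm_ba_def conj_by_def bpow_add group_norm)

text \<open>The derived subgroup, as the normal closure of the commutators of powers of b and a. The
  clauses match the rules available for \<open>linked\<close>.\<close>

inductive_set comm_closure :: "'p mod_ring raut set" where
  comm_ba: "comm_ba s t \<in> comm_closure"
| uminus: "u \<in> comm_closure \<Longrightarrow> - u \<in> comm_closure"
| add: "u \<in> comm_closure \<Longrightarrow> v \<in> comm_closure \<Longrightarrow> u + v \<in> comm_closure"
| conj_by: "u \<in> comm_closure \<Longrightarrow> g \<in> G \<Longrightarrow> conj_by g u \<in> comm_closure"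

text \<open>The commutator of b^s with a conjugate of b^s' by a^i. Away from \<open>0\<close> and
  \<open>i\<close> both sections are powers of a and commute; at \<open>i\<close> the roles of a and
  b are exchanged, which gives the inverse.\<close>

lemma linked_comm_ba:
  assumes "i \<noteq> 0"
  shows "linked i (comm_ba s (s' * e (- i))) (comm_ba s' (s * e i))"
proof -
  have "- b_conj 0 s - b_conj i s' + b_conj 0 s + b_conj i s' =
      only_at 0 (comm_ba s (s' * e (- i))) - only_at i (comm_ba s' (s * e i))"
  proof (rule raut_eqI)
    fix j
    let ?x = "sec j (b_conj 0 s)" and ?y = "sec j (b_conj i s')"
    let ?l = "comm_ba s (s' * e (- i))" and ?r = "comm_ba s' (s * e i)"
    have "- ?x - ?y + ?x + ?y = (if j = 0 then ?l else if j = i then - ?r else 0)"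
    proof -
      consider "j = 0" | "j = i" "j \<noteq> 0" | "j \<noteq> 0" "j \<noteq> i" by blast
      then show ?thesis
      proof cases
        case 1
        then show ?thesis
          using assms by (simp add: sec_b_conj comm_ba_def)
      next
        case 2
        have "- ?r = - apow (s * e i) - bpow s' + apow (s * e i) + bpow s'"
          by (simp only: comm_ba_def group_norm)
        then show ?thesis
          using 2 by (simp add: sec_b_conj)
      next
        case 3
        have "apow c + apow d = apow d + apow c" for c d
          by (simp add: apow_add[symmetric] add.commute)
        then have "- apow c - apow d + apow c + apow d = 0" for c d
          by (metis add.assoc diff_conv_add_uminus minus_add right_minus left_minus)
        then show ?thesis
          using 3 by (simp add: sec_b_conj)
      qed
    qed
    then show "sec j (- b_conj 0 s - b_conj i s' + b_conj 0 s + b_conj i s')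
        = sec j (only_at 0 ?l - only_at i ?r)"
      using assms by (auto simp: sec_only_at diff_conv_add_uminus simp del: add_uminus_conv_diff)
  qed simp
  moreover have "- b_conj 0 s - b_conj i s' + b_conj 0 s + b_conj i s' \<in> G"
    by (simp add: G.add G_diff G_uminus b_conj_in_G)
  ultimately show ?thesis by (simp add: linked_def)
qed


text \<open>Existence of a partner under the relation phi. Since \<open>e (- i)\<close> is
  invertible, \<open>linked_comm_ba\<close> reaches every generating commutator, and the closure
  rules carry this to the whole derived subgroup.\<close>

lemma linked_pow_step:
  assumes i: "i \<noteq> 0" "e (- i) \<noteq> 0" and "u \<in> comm_closure"
  shows "\<exists>v\<in>comm_closure. linked i u v"
  using assms(3)
proof (induction rule: comm_closure.induct)
  case (comm_ba s t)
  then show ?case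
    using linked_comm_ba[OF i(1), of s "t / e (- i)"] i(2) comm_closure.comm_ba by (intro bexI) simp_all
next
  case (uminus u)
  then show ?case
    using linked_uminus i(1) comm_closure.uminus by blast
next
  case (add u v)
  then show ?case
    using linked_add i(1) comm_closure.add by blast
next
  case (conj_by u g)
  obtain w where "w \<in> G" "rot w = 0" "sec 0 w = g"
    by (rule stab_lift[OF conj_by.hyps(2)])
  moreover obtain v where "v \<in> comm_closure" "linked i u v"
    using conj_by.IH by blast
  ultimately show ?case
    using linked_conj_by[of i u v w] by (auto intro!: bexI[of _ "conj_by (sec i w) v"] comm_closure.conj_by sec_in_G)
qed

text \<open>The sections of \<open>b_conj i s\<close> at \<open>0\<close> and \<open>i\<close> are a
  power of a and a power of b; those of \<open>b_conj 0 s\<close> in \<open>linked_conj_b\<close>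
  have the roles exchanged.\<close>

lemma linked_conj_a:
  assumes "linked i u v" "i \<noteq> 0"
  shows "linked i (conj_by (apow (s * e (- i))) u) (conj_by (bpow s) v)"
  using linked_conj_by[OF assms(1) b_conj_in_G[of i s] rot_b_conj] assms(2) by (simp add: sec_b_conj)

lemma linked_conj_b:
  assumes "linked i u v" "i \<noteq> 0"
  shows "linked i (conj_by (bpow s) u) (conj_by (apow (s * e i)) v)"
  using linked_conj_by[OF assms(1) b_conj_in_G[of 0 s] rot_b_conj] assms(2) by (simp add: sec_b_conj)

text \<open>Two steps of length \<open>i\<close> multiply the exponent of the conjugating power of a
  by \<open>t\<close>, passing through a power of b. It matters that one \<open>v\<close> serves all
  \<open>k\<close>.\<close>

lemma linked_conj_pow:
  fixes i defines "t \<equiv> e i / e (- i)"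
  assumes i: "i \<noteq> 0" "e (- i) \<noteq> 0" and "u \<in> comm_closure"
  shows "\<exists>v\<in>comm_closure. \<forall>k. 
    linked (of_nat n * (i + i)) (conj_by (apow k) u) (conj_by (apow (k * t ^ n)) v)"
proof (induction n)
  case 0
  then show ?case using \<open>u \<in> comm_closure\<close> by (intro bexI[of _ u]) simp_all
next
  case (Suc n)
  then obtain v where v: "v \<in> comm_closure"
    "\<And>k. linked (of_nat n * (i + i)) (conj_by (apow k) u) (conj_by (apow (k * t ^ n)) v)"
    by blast
  obtain v' where v': "v' \<in> comm_closure" "linked i v v'"
    using linked_pow_step[OF i v(1)] by blast
  obtain v'' where v'': "v'' \<in> comm_closure" "linked i v' v''"
    using linked_pow_step[OF i v'(1)] by blast
  have "linked (of_nat (Suc n) * (i + i)) (conj_by (apow k) u) (conj_by (apow (k * t ^ Suc n)) v'')" for k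
  proof -
    \<comment> \<open>Chosen so that \<open>s * e (- i)\<close> is the current exponent; then
      \<open>s * e i\<close> is the next one.\<close>
    define s where "s = k * t ^ n / e (- i)"
    have "linked i (conj_by (apow (k * t ^ n)) v) (conj_by (bpow s) v')"
      using linked_conj_a[OF v'(2) i(1), of s] i(2) by (simp add: s_def)
    moreover have "linked i (conj_by (bpow s) v') (conj_by (apow (k * t ^ Suc n)) v'')"
      using linked_conj_b[OF v''(2) i(1), of s] i(2) by (simp add: s_def t_def mult_ac)
    ultimately have "linked (i + i) (conj_by (apow (k * t ^ n)) v) (conj_by (apow (k * t ^ Suc n)) v'')"
      by (rule linked_trans)
    from linked_trans[OF v(2) this] show ?thesis
      by (simp add: algebra_simps)
  qed
  then show ?case using v''(1) by blast
qed

lemma of_nat_card_mod_ring: "of_nat CARD('p) = (0 :: 'p mod_ring)"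
  by simp

lemma pow_card_mod_ring: "x ^ CARD('p) = (x :: 'p mod_ring)"
  using finite_field_power_card_eq_same[of x] by simp

lemma of_nat_surj_mod_ring: "\<exists>n. x = (of_nat n :: 'p mod_ring)"
  using surj_of_nat_mod_ring by blast

lemma comm_closure_centralises_apow:
  assumes i: "e (- i) \<noteq> 0" "e i \<noteq> e (- i)" and u: "u \<in> comm_closure"
  shows "linked 0 (conj_by (apow k) u) u"
proof -
  define t where "t = e i / e (- i)"
  have i0: "i \<noteq> 0"
    using i by auto
  have t: "t \<noteq> 1"
    using i by (simp add: t_def)
  \<comment> \<open>After p double steps the position is \<open>0\<close> again, and t^p =
    t.\<close>
  obtain v where v: "\<And>k. linked 0 (conj_by (apow k) u) (conj_by (apow (k * t)) v)"
    using linked_conj_pow[OF i0 i(1) u, of "CARD('p)"]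
    unfolding of_nat_card_mod_ring pow_card_mod_ring t_def by auto
  \<comment> \<open>The instance \<open>k = 0\<close> identifies \<open>v\<close> with
    \<open>u\<close> modulo \<open>linked 0\<close>, so \<open>v\<close> can be eliminated.\<close>
  have "linked 0 v u"
    using v[of 0] linked_0_sym by simp
  have *: "linked 0 (conj_by (apow k) u) (conj_by (apow (k * t)) u)" for k
    using v[of k] linked_0_conj_by[OF \<open>linked 0 v u\<close> G.apow] linked_0_trans by blast
  \<comment> \<open>Conjugation by a^m and by a^(m t) agree on \<open>u\<close>, so a^(m (1 - t))
    acts trivially; \<open>m\<close> makes this exponent equal to \<open>k\<close>.\<close>
  define m where "m = k / (1 - t)"
  have "linked 0 (conj_by (apow (- (m * t))) (conj_by (apow m) u))
      (conj_by (apow (- (m * t))) (conj_by (apow (m * t)) u))"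
    by (intro linked_0_conj_by * G.apow)
  moreover have "m + - (m * t) = k"
  proof -
    have "m * (1 - t) = k"
      using t by (simp add: m_def)
    then show ?thesis
      by (simp add: right_diff_distrib)
  qed
  ultimately show ?thesis
    by (simp add: conj_by_conj_by apow_add[symmetric])
qed

text \<open>One step to position \<open>i\<close> turns conjugation by a power of b into conjugation
  by a power of a, which is already known to be trivial; the step back returns to
  \<open>u\<close>.\<close>

lemma comm_closure_centralises_bpow:
  assumes i: "e (- i) \<noteq> 0" "e i \<noteq> e (- i)" and u: "u \<in> comm_closure"
  shows "linked 0 (conj_by (bpow s) u) u"
proof -
  have i0: "i \<noteq> 0"
    using i by auto
  obtain v where v: "v \<in> comm_closure" "linked i u v"
    using linked_pow_step[OF i0 i(1) u] by blast
  have "linked i (conj_by (bpow s) u) v"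
    using linked_trans[OF linked_conj_b[OF v(2) i0] comm_closure_centralises_apow[OF i v(1)]] by simp
  from linked_trans[OF this linked_sym[OF v(2)]] show ?thesis by simp
qed

text \<open>Commutators are central modulo \<open>linked 0\<close> and therefore bilinear in the
  exponents; the proof adds up copies of b, using that every \<open>s\<close> is the image of a
  natural number.\<close>

lemma comm_ba_one:
  assumes i: "e (- i) \<noteq> 0" "e i \<noteq> e (- i)"
  shows "linked 0 (comm_ba s t) (comm_ba 1 (s * t))"
proof -
  have "linked 0 (comm_ba (of_nat n) t) (comm_ba 1 (of_nat n * t))" for n
  proof (induction n)
    case (Suc n)
    have "linked 0 (conj_by (bpow (of_nat n)) (comm_ba 1 t) + comm_ba (of_nat n) t)
        (comm_ba 1 t + comm_ba 1 (of_nat n * t))"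
      using Suc by (intro linked_0_add comm_closure_centralises_bpow[OF i] comm_closure.comm_ba
          G_conj_by G.bpow comm_ba_in_G)
    moreover have "linked 0 (comm_ba 1 t + conj_by (apow t) (comm_ba 1 (of_nat n * t)))
        (comm_ba 1 t + comm_ba 1 (of_nat n * t))"
      by (intro linked_0_add comm_closure_centralises_apow[OF i] comm_closure.comm_ba linked_refl comm_ba_in_G)
    ultimately have "linked 0 (comm_ba (1 + of_nat n) t) (comm_ba 1 (of_nat n * t + t))"
      unfolding comm_ba_add_left comm_ba_add_right by (rule linked_0_trans[OF _ linked_0_sym])
    then show ?case
      by (simp add: algebra_simps)
  qed simp
  then show ?thesis
    using of_nat_surj_mod_ring[of s] by auto
qed

text \<open>Each step moves the factor \<open>r * t ^ n / e (- i)\<close> onto b and leaves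
  \<open>e i\<close> on a; bilinearity collects both on a, which multiplies the exponent by
  \<open>t\<close>.\<close>

lemma linked_comm_ba_pow:
  fixes i defines "t \<equiv> e i / e (- i)"
  assumes i: "e (- i) \<noteq> 0" "e i \<noteq> e (- i)"
  shows "linked (of_nat n * i) (comm_ba 1 r) (comm_ba 1 (r * t ^ n))"
proof (induction n)
  case (Suc n)
  have i0: "i \<noteq> 0"
    using i by auto
  have "linked i (comm_ba 1 (r * t ^ n)) (comm_ba (r * t ^ n / e (- i)) (e i))"
    using linked_comm_ba[OF i0, of 1 "r * t ^ n / e (- i)"] i by simp
  from linked_trans[OF this comm_ba_one[OF i]]
  have "linked i (comm_ba 1 (r * t ^ n)) (comm_ba 1 (r * t ^ Suc n))"
    by (simp add: t_def mult_ac)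
  from linked_trans[OF Suc this] show ?case
    by (simp add: algebra_simps)
qed simp

lemma comm_ba_linked_0: "linked 0 (comm_ba s r) 0"
proof -
  obtain i where i: "e (- i) \<noteq> 0" "e i \<noteq> e (- i)"
  proof -
    obtain j where j: "e j \<noteq> e (- j)"
      \<comment> \<open>If \<open>e (- j)\<close> vanishes, then \<open>e j\<close> does not, and
        passing to \<open>- j\<close> gives a non-zero \<open>e (- i)\<close>.\<close>
      using nonsym by blast
    show thesis
    proof (cases "e (- j) = 0")
      case True
      then show thesis using j that[of "- j"] by simp
    next
      case False
      then show thesis using j that by blast
    qed
  qed
  then have i0: "i \<noteq> 0" by auto
  show ?thesis
  proof (cases "e i = 0")
    case True
    have "linked i (comm_ba s r) 0"
      using linked_comm_ba[OF i0, of s "r / e (- i)"] i True by simp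
    then show ?thesis
      by (simp add: linked_def)
  next
    case False
    define t where "t = e i / e (- i)"
    \<comment> \<open>Chosen so that \<open>q * t - q = s * r\<close>: the congruence between the
      commutators with exponents \<open>q\<close> and \<open>q * t\<close> then leaves exactly the
      commutator with exponent \<open>s * r\<close>.\<close>
    define q where "q = s * r / (t - 1)"
    have t: "t \<noteq> 1"
      using i by (simp add: t_def)
    have "linked 0 (comm_ba 1 q) (comm_ba 1 (q * t))"
      using linked_comm_ba_pow[OF i, of "CARD('p)" q]
      unfolding of_nat_card_mod_ring pow_card_mod_ring t_def by simp
    also have "q * t = s * r + q"
    proof -
      have "q * (t - 1) = s * r"
        using t by (simp add: q_def)
      then show ?thesis
        by (simp add: algebra_simps)
    qed
    also have "comm_ba 1 (s * r + q) = comm_ba 1 q + conj_by (apow q) (comm_ba 1 (s * r))"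
      by (rule comm_ba_add_right)
    finally have "linked 0 (comm_ba 1 q) (comm_ba 1 q + conj_by (apow q) (comm_ba 1 (s * r)))" .
    moreover have "linked 0 (comm_ba 1 q + conj_by (apow q) (comm_ba 1 (s * r))) (comm_ba 1 q + comm_ba 1 (s * r))"
      by (intro linked_0_add comm_closure_centralises_apow[OF i] comm_closure.comm_ba linked_refl comm_ba_in_G)
    ultimately have "linked 0 (comm_ba 1 q) (comm_ba 1 q + comm_ba 1 (s * r))"
      by (rule linked_0_trans)
    then have "linked 0 (- comm_ba 1 q + comm_ba 1 q) (- comm_ba 1 q + (comm_ba 1 q + comm_ba 1 (s * r)))"
      by (intro linked_0_add linked_refl G_uminus comm_ba_in_G)
    then have "linked 0 (comm_ba 1 (s * r)) 0"
      by (simp add: linked_0_sym)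
    then show ?thesis
      using comm_ba_one[OF i] linked_0_trans by blast
  qed
qed


section \<open>Depth and the exponent of b\<close>

definition nuc :: "'p mod_ring raut set" where
  "nuc = range apow \<union> range bpow"

lemma nuc_cases:
  assumes "g \<in> nuc" obtains (apow) s where "g = apow s" | (bpow) s where "g = bpow s"
  using assms by (auto simp: nuc_def)

lemma apow_in_nuc [simp]: "apow s \<in> nuc" and bpow_in_nuc [simp]: "bpow s \<in> nuc"
  by (auto simp: nuc_def)

lemma zero_in_nuc [simp]: "0 \<in> nuc"
  using apow_in_nuc[of 0] by simp

lemma sec_in_nuc: "g \<in> nuc \<Longrightarrow> sec k g \<in> nuc"
  by (erule nuc_cases) (simp_all add: sec_bpow)

primrec depth_at_most :: "nat \<Rightarrow> 'p mod_ring raut \<Rightarrow> bool" where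
  "depth_at_most 0 g \<longleftrightarrow> g \<in> nuc"
| "depth_at_most (Suc n) g \<longleftrightarrow> (\<forall>k. depth_at_most n (sec k g))"

text \<open>The powers of a and of b meet only in the identity, where both readings give exponent
  \<open>0\<close>.\<close>

definition nuc_b_exp :: "'p mod_ring raut \<Rightarrow> 'p mod_ring" where
  "nuc_b_exp g = (if g \<in> range bpow then the_inv bpow g else 0)"

lemma nuc_b_exp_bpow [simp]: "nuc_b_exp (bpow s) = s"
  by (simp add: nuc_b_exp_def the_inv_f_f inj_def)

lemma nuc_b_exp_zero [simp]: "nuc_b_exp 0 = 0"
  using nuc_b_exp_bpow[of 0] by simp

lemma nuc_b_exp_apow [simp]: "nuc_b_exp (apow s) = 0"
  using nuc_b_exp_zero by (cases "s = 0") (auto simp: nuc_b_exp_def)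

text \<open>The section of a power of b at \<open>0\<close> is that power itself, and all other
  sections of nucleus elements are powers of a, which contribute \<open>0\<close>.\<close>

lemma sum_nuc_b_exp_sec: "g \<in> nuc \<Longrightarrow> (\<Sum>k\<in>UNIV. nuc_b_exp (sec k g)) = nuc_b_exp g"
  by (erule nuc_cases) (simp_all add: sec_bpow if_distrib[of nuc_b_exp] cong: if_cong)

text \<open>Below the depth of \<open>g\<close> this sum over the sections at level \<open>n\<close> no longer depends on \<open>n\<close>, which
  makes the exponent of \<open>b\<close> well defined without reference to words in the generators.\<close>

primrec b_exp_at :: "nat \<Rightarrow> 'p mod_ring raut \<Rightarrow> 'p mod_ring" where
  "b_exp_at 0 g = nuc_b_exp g"
| "b_exp_at (Suc n) g = (\<Sum>k\<in>UNIV. b_exp_at n (sec k g))"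

lemma depth_at_most_Suc: "depth_at_most n g \<Longrightarrow> depth_at_most (Suc n) g"
proof (induction n arbitrary: g)
  case 0 then show ?case by (simp add: sec_in_nuc)
next
  case (Suc n) then show ?case by (metis depth_at_most.simps(2))
qed

lemma depth_at_most_mono: "m \<le> n \<Longrightarrow> depth_at_most m g \<Longrightarrow> depth_at_most n g"
  by (induction rule: dec_induct) (simp_all add: depth_at_most_Suc del: depth_at_most.simps)

lemma b_exp_at_Suc: "depth_at_most n g \<Longrightarrow> b_exp_at (Suc n) g = b_exp_at n g"
proof (induction n arbitrary: g)
  case 0 then show ?case by (simp add: sum_nuc_b_exp_sec)
next
  case (Suc n)
  then have "b_exp_at (Suc n) (sec k g) = b_exp_at n (sec k g)" for k by simp
  then show ?case by (subst b_exp_at.simps) simp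
qed

lemma b_exp_at_mono: "m \<le> n \<Longrightarrow> depth_at_most m g \<Longrightarrow> b_exp_at n g = b_exp_at m g"
  by (induction rule: dec_induct) (metis b_exp_at_Suc depth_at_most_mono)+

lemma sum_sec_shift: "(\<Sum>k\<in>UNIV. f (k + c)) = (\<Sum>k\<in>UNIV. f (k :: 'p mod_ring) :: 'p mod_ring)"
  by (rule sum.reindex_bij_witness[of _ "\<lambda>k. k - c" "\<lambda>k. k + c"]) auto

text \<open>A sum of two nucleus elements may leave the nucleus, but its sections do not; hence the
  one extra level. The sections of \<open>h\<close> enter shifted by \<open>rot g\<close>, which
  does not affect the sum.\<close>

lemma depth_at_most_b_exp_at_add:
  assumes "depth_at_most n g" "depth_at_most n h"
  shows "depth_at_most (Suc n) (g + h) \<and> b_exp_at (Suc n) (g + h) = b_exp_at n g + b_exp_at n h"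
  using assms
proof (induction n arbitrary: g h)
  case 0
  then have gh: "g \<in> nuc" "h \<in> nuc" by simp_all
  from gh(1) show ?case
  proof (cases rule: nuc_cases)
    case (apow s)
    then show ?thesis
      using gh(2) sum_nuc_b_exp_sec[OF gh(2)] sum_sec_shift[of "\<lambda>k. nuc_b_exp (sec k h)" s]
      by (simp add: sec_in_nuc)
  next
    case (bpow s)
    note g = this
    from gh(2) show ?thesis
    proof (cases rule: nuc_cases)
      case (apow t)
      then show ?thesis
        using g gh(1) sum_nuc_b_exp_sec[OF gh(1)] by (simp add: sec_in_nuc)
    next
      case (bpow t)
      then show ?thesis
        using g sum_nuc_b_exp_sec[of "bpow (s + t)"] sec_in_nuc[of "bpow (s + t)"]
        by (simp add: bpow_add[symmetric] del: sec_plus)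
    qed
  qed
next
  case (Suc n)
  have *: "depth_at_most (Suc n) (sec k (g + h)) \<and>
      b_exp_at (Suc n) (sec k (g + h)) = b_exp_at n (sec k g) + b_exp_at n (sec (k + rot g) h)" for k
    using Suc.IH[of "sec k g" "sec (k + rot g) h"] Suc.prems by simp
  have "b_exp_at (Suc (Suc n)) (g + h) = (\<Sum>k\<in>UNIV. b_exp_at (Suc n) (sec k (g + h)))"
    by (rule b_exp_at.simps)
  also have "\<dots> = (\<Sum>k\<in>UNIV. b_exp_at n (sec k g)) + (\<Sum>k\<in>UNIV. b_exp_at n (sec (k + rot g) h))"
    using * by (simp add: sum.distrib del: b_exp_at.simps sec_plus)
  also have "(\<Sum>k\<in>UNIV. b_exp_at n (sec (k + rot g) h)) = (\<Sum>k\<in>UNIV. b_exp_at n (sec k h))"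
    by (rule sum_sec_shift)
  finally have "b_exp_at (Suc (Suc n)) (g + h) = b_exp_at (Suc n) g + b_exp_at (Suc n) h"
    by simp
  moreover have "depth_at_most (Suc (Suc n)) (g + h)"
    using * by simp
  ultimately show ?case by blast
qed

text \<open>Contraction: a product costs at most one level beyond a common bound for its
  factors.\<close>

lemma G_depth_at_most: "g \<in> G \<Longrightarrow> \<exists>n. depth_at_most n g"
proof (induction rule: G.induct)
  case (apow s) then show ?case by (intro exI[of _ 0]) simp
next
  case (bpow s) then show ?case by (intro exI[of _ 0]) simp
next
  case (add g h)
  then obtain m n where "depth_at_most m g" "depth_at_most n h" by blast
  then have "depth_at_most (max m n) g" "depth_at_most (max m n) h"
    using depth_at_most_mono max.cobounded1 max.cobounded2 by blast+
  then show ?case using depth_at_most_b_exp_at_add by blast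
qed

section \<open>The exponent of b as a homomorphism\<close>

definition b_exp :: "'p mod_ring raut \<Rightarrow> 'p mod_ring" where
  "b_exp g = b_exp_at (LEAST n. depth_at_most n g) g"

lemma b_exp_eq: "depth_at_most n g \<Longrightarrow> b_exp g = b_exp_at n g"
  unfolding b_exp_def using b_exp_at_mono LeastI Least_le by metis

lemma b_exp_apow [simp]: "b_exp (apow s) = 0"
  and b_exp_bpow [simp]: "b_exp (bpow s) = s"
  using b_exp_eq[of 0] by simp_all

lemma b_exp_zero [simp]: "b_exp 0 = 0"
  using b_exp_apow[of 0] by simp

lemma b_exp_add:
  assumes "g \<in> G" "h \<in> G" shows "b_exp (g + h) = b_exp g + b_exp h"
proof -
  obtain m n where "depth_at_most m g" "depth_at_most n h"
    using assms G_depth_at_most by blast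
  then have "depth_at_most (max m n) g" "depth_at_most (max m n) h"
    using depth_at_most_mono max.cobounded1 max.cobounded2 by blast+
  then show ?thesis
    using depth_at_most_b_exp_at_add b_exp_eq by metis
qed

section \<open>Section tuples of the level stabiliser\<close>

lemma b_exp_sec_b_conj: "b_exp (sec j (b_conj i s)) = (if j = i then s else 0)"
  by (simp add: sec_b_conj)

text \<open>True for powers of a and b, and compatible with products: the sections of the second
  factor are shifted by \<open>rot g\<close>, and convolution commutes with shifts.\<close>

lemma rot_sec:
  "g \<in> G \<Longrightarrow> rot (sec j g) = (\<Sum>i\<in>UNIV. b_exp (sec i g) * e (j - i))"
proof (induction arbitrary: j rule: G.induct)
  case (apow s)
  then show ?case by simp
next
  case (bpow s)
  have "b_exp (sec i (bpow s)) * e (j - i) = (if i = 0 then s * e j else 0)" for i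
    by (simp add: sec_bpow)
  then show ?case by (simp add: sec_bpow)
next
  case (add g h)
  have "(\<Sum>i\<in>UNIV. b_exp (sec i h) * e (j + rot g - i))
      = (\<Sum>i\<in>UNIV. b_exp (sec (i + rot g) h) * e (j + rot g - (i + rot g)))"
    by (rule sum_sec_shift[symmetric])
  then show ?case
    using add by (simp add: b_exp_add sec_in_G distrib_right sum.distrib)
qed

text \<open>Powers of a and b commute modulo \<open>linked 0\<close>, so they can be
  collected.\<close>

lemma linked_normal_form: "g \<in> G \<Longrightarrow> linked 0 g (apow (rot g) + bpow (b_exp g))"
proof (induction rule: G.induct)
  case (apow s)
  then show ?case by simp
next
  case (bpow s)
  then show ?case by simp
next
  case (add g h)
  let ?i = "rot g" and ?j = "rot h" and ?s = "b_exp g" and ?t = "b_exp h"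
  have "linked 0 (g + h) (apow ?i + bpow ?s + (apow ?j + bpow ?t))"
    using add by (intro linked_0_add)
  \<comment> \<open>Moving \<open>apow ?j\<close> to the left past \<open>bpow ?s\<close> leaves the
    commutator \<open>comm_ba ?s ?j\<close> behind.\<close>
  also have "apow ?i + bpow ?s + (apow ?j + bpow ?t)
      = apow ?i + apow ?j + bpow ?s + (comm_ba ?s ?j + bpow ?t)"
    by (simp only: comm_ba_def group_norm)
  finally have "linked 0 (g + h) (apow ?i + apow ?j + bpow ?s + (comm_ba ?s ?j + bpow ?t))" .
  moreover have "linked 0 (apow ?i + apow ?j + bpow ?s + (comm_ba ?s ?j + bpow ?t))
      (apow ?i + apow ?j + bpow ?s + (0 + bpow ?t))"
    by (intro linked_0_add linked_refl comm_ba_linked_0 G.intros comm_ba_in_G)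
  ultimately have "linked 0 (g + h) (apow ?i + apow ?j + bpow ?s + (0 + bpow ?t))"
    by (rule linked_0_trans)
  then show ?case
    using add.hyps by (simp add: b_exp_add apow_add bpow_add add.assoc)
qed

text \<open>The sections are replaced one position at a time; each replacement is multiplication by
  an \<open>only_at j\<close> element, conjugated by a power of a from position
  \<open>0\<close>.\<close>

lemma G_change_sections:
  assumes "h \<in> G" "rot h = 0" "\<And>j. linked 0 (sec j h) (f j)"
  shows "mk 0 f \<in> G"
proof -
  have "mk 0 (\<lambda>j. if j \<in> S then f j else sec j h) \<in> G" if "finite S" for S
    using that
  proof (induction S rule: finite_induct)
    case empty
    then show ?case
      using assms(1,2) mk_rot_sec[of h] by simp
  next
    case (insert j S)
    let ?d = "- sec j h + f j"
    have "linked 0 (- sec j h + sec j h) ?d"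
      using assms by (intro linked_0_add linked_refl G_uminus sec_in_G)
    then have "linked 0 0 ?d"
      by simp
    then have "linked 0 ?d 0"
      by (rule linked_0_sym)
    then have "only_at 0 ?d \<in> G"
      by (simp only: linked_0_zero_iff)
    from G_conj_by[OF G.apow this, of j] have "only_at j ?d \<in> G"
      by (simp add: conj_by_apow_only_at)
    moreover have "mk 0 (\<lambda>i. if i \<in> insert j S then f i else sec i h)
        = mk 0 (\<lambda>i. if i \<in> S then f i else sec i h) + only_at j ?d"
      (is "?x = ?y")
    proof (rule raut_eqI)
      fix i
      have "f j = sec j h + ?d"
        by (simp only: group_norm)
      then show "sec i ?x = sec i ?y"
        using insert.hyps by (cases "i = j") (simp_all add: sec_only_at)
    qed simp
    ultimately show ?case
      using insert.IH G.add by simp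
  qed
  from this[of UNIV] show ?thesis by simp
qed

text \<open>The factor \<open>b_conj i (n i)\<close> affects the exponent of b only in the section
  at \<open>i\<close>, so the positions can be treated independently.\<close>

lemma ex_stab_b_exp: "\<exists>h\<in>G. rot h = 0 \<and> (\<forall>j. b_exp (sec j h) = n j)"
proof -
  have "\<exists>h\<in>G. rot h = 0 \<and> (\<forall>j. b_exp (sec j h) = (if j \<in> S then n j else 0))"
    if "finite S" for S
    using that
  proof (induction S rule: finite_induct)
    case empty
    then show ?case by (intro bexI[of _ 0]) simp_all
  next
    case (insert i S)
    then obtain h where "h \<in> G" "rot h = 0"
      "\<And>j. b_exp (sec j h) = (if j \<in> S then n j else 0)" by blast
    then show ?case
      using insert.hyps
      by (intro bexI[of _ "h + b_conj i (n i)"])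
         (auto simp: b_exp_add sec_in_G b_conj_in_G b_exp_sec_b_conj G.add)
  qed
  from this[of UNIV] show ?thesis by simp
qed

text \<open>For the converse, take an element of the stabiliser with the required exponents of b.
  The convolution forces its sections to have the rotations of \<open>f\<close> as well, hence the
  same normal forms.\<close>

lemma mk_in_G_iff:
  "mk 0 f \<in> G \<longleftrightarrow>
    (\<forall>j. f j \<in> G) \<and> (\<forall>j. rot (f j) = (\<Sum>i\<in>UNIV. b_exp (f i) * e (j - i)))"
proof
  assume "mk 0 f \<in> G"
  then show "(\<forall>j. f j \<in> G) \<and> (\<forall>j. rot (f j) = (\<Sum>i\<in>UNIV. b_exp (f i) * e (j - i)))"
    using sec_in_G[of "mk 0 f"] rot_sec[of "mk 0 f"] by simp
next
  assume f: "(\<forall>j. f j \<in> G) \<and> (\<forall>j. rot (f j) = (\<Sum>i\<in>UNIV. b_exp (f i) * e (j - i)))"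
  obtain h where h: "h \<in> G" "rot h = 0" "\<And>j. b_exp (sec j h) = b_exp (f j)"
    using ex_stab_b_exp[of "\<lambda>j. b_exp (f j)"] by blast
  have "linked 0 (sec j h) (f j)" for j
  proof -
    have "rot (sec j h) = rot (f j)"
      using f h by (simp add: rot_sec)
    then show ?thesis
      using linked_normal_form[OF sec_in_G[OF h(1), of j]] linked_normal_form[of "f j"] f h(3)[of j]
        linked_0_trans linked_0_sym by metis
  qed
  then show "mk 0 f \<in> G"
    by (rule G_change_sections[OF h(1,2)])
qed


section \<open>Counting elements by depth\<close>

definition upto_depth :: "nat \<Rightarrow> 'p mod_ring raut set" where
  "upto_depth n = {g \<in> G. depth_at_most n g}"

definition stab_upto_depth :: "nat \<Rightarrow> 'p mod_ring raut set" where
  "stab_upto_depth n = {g \<in> upto_depth n. rot g = 0}"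

definition circ_conv :: "('p mod_ring \<Rightarrow> 'p mod_ring) \<Rightarrow> 'p mod_ring \<Rightarrow> 'p mod_ring" where
  "circ_conv v j = (\<Sum>i\<in>UNIV. v i * e (j - i))"

lemma nuc_subset_G: "g \<in> nuc \<Longrightarrow> g \<in> G"
  by (erule nuc_cases) (simp_all add: G.apow G.bpow)

lemma upto_depth_0: "upto_depth 0 = nuc"
  using nuc_subset_G by (auto simp: upto_depth_def)

lemma card_upto_depth_0: "card (upto_depth 0) = 1 + 2 * (CARD('p) - 1)"
proof -
  \<comment> \<open>The identity is counted among the powers of a and removed from the powers of
    b.\<close>
  have "range bpow = bpow ` insert 0 (UNIV - {0})"
    by simp
  also have "\<dots> = insert (apow 0) (bpow ` (UNIV - {0}))"
    by (simp only: image_insert bpow_0 apow_0)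
  finally have "nuc = range apow \<union> bpow ` (UNIV - {0})"
    unfolding nuc_def using rangeI[of apow 0] by blast
  then have "card (upto_depth 0) = card (range apow \<union> bpow ` (UNIV - {0}))"
    by (simp only: upto_depth_0)
  moreover have "card (range apow \<union> bpow ` (UNIV - {0})) =
      card (range (apow :: _ \<Rightarrow> 'p mod_ring raut)) + card (bpow ` (UNIV - {0}))"
    by (rule card_Un_disjoint) auto
  moreover have "card (range (apow :: _ \<Rightarrow> 'p mod_ring raut)) = CARD('p)"
    by (subst card_image) (simp_all add: inj_def)
  moreover have "card (bpow ` (UNIV - {0})) = CARD('p) - 1"
    by (subst card_image) (simp_all add: inj_on_def card_Diff_singleton)
  moreover have "CARD('p) > 0"
    by simp
  ultimately show ?thesis by linarith
qed

text \<open>Multiplication by a power of a on the right keeps all first-level sections. The bound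
  has to be positive, since the product of a nucleus element with a power of a may leave the
  nucleus.\<close>

lemma add_apow_in_upto_depth: "g \<in> upto_depth (Suc n) \<Longrightarrow> g + apow s \<in> upto_depth (Suc n)"
  by (simp add: upto_depth_def G.add G.apow)

lemma diff_apow_in_upto_depth: "g \<in> upto_depth (Suc n) \<Longrightarrow> g - apow s \<in> upto_depth (Suc n)"
  using add_apow_in_upto_depth[of g n "- s"] by (simp add: apow_uminus)

lemma card_upto_depth_Suc: "card (upto_depth (Suc n)) = CARD('p) * card (stab_upto_depth (Suc n))"
proof -
  have "bij_betw (\<lambda>(s, g). g + apow s) (UNIV \<times> stab_upto_depth (Suc n)) (upto_depth (Suc n))"
    by (rule bij_betwI[where g = "\<lambda>g. (rot g, g - apow (rot g))"])
       (auto simp: stab_upto_depth_def add_apow_in_upto_depth diff_apow_in_upto_depth)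
  from bij_betw_same_card[OF this] show ?thesis
    by (simp add: card_cartesian_product)
qed

definition stab_sections :: "nat \<Rightarrow> ('p mod_ring \<Rightarrow> 'p mod_ring raut) set" where
  "stab_sections n = {f. (\<forall>j. f j \<in> upto_depth n) \<and> (\<forall>j. rot (f j) = circ_conv (\<lambda>i. b_exp (f i)) j)}"

lemma card_stab_upto_depth_Suc: "card (stab_upto_depth (Suc n)) = card (stab_sections n)"
proof -
  have "bij_betw (mk 0) (stab_sections n) (stab_upto_depth (Suc n))"
    by (rule bij_betwI[where g = "\<lambda>g k. sec k g"])
       (auto simp: stab_sections_def stab_upto_depth_def upto_depth_def circ_conv_def mk_in_G_iff rot_sec sec_in_G
          intro: raut_eqI)
  from bij_betw_same_card[OF this] show ?thesis
    by simp
qed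

text \<open>The exponents of b prescribe the rotations of the entries. Stripping these off changes
  neither the exponents nor a positive depth bound, and leaves an unconstrained p-tuple from the
  stabiliser.\<close>

lemma card_stab_sections_Suc: "card (stab_sections (Suc n)) = card (stab_upto_depth (Suc n)) ^ CARD('p)"
proof -
  let ?F = "\<lambda>h j. h j + apow (circ_conv (\<lambda>i. b_exp (h i)) j)"
  have b_exp: "b_exp (g + apow s) = b_exp g" if "g \<in> upto_depth m" for g s m
    using that by (simp add: upto_depth_def b_exp_add G.apow)
  have "bij_betw ?F (UNIV \<rightarrow> stab_upto_depth (Suc n)) (stab_sections (Suc n))"
  proof (rule bij_betwI[where g = "\<lambda>f j. f j - apow (rot (f j))"])
    show "?F \<in> (UNIV \<rightarrow> stab_upto_depth (Suc n)) \<rightarrow> stab_sections (Suc n)"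
    proof
      fix h :: "'p mod_ring \<Rightarrow> 'p mod_ring raut" assume "h \<in> UNIV \<rightarrow> stab_upto_depth (Suc n)"
      then have "h j \<in> upto_depth (Suc n)" "rot (h j) = 0" for j
        by (auto simp: stab_upto_depth_def)
      then show "?F h \<in> stab_sections (Suc n)"
        by (simp add: stab_sections_def add_apow_in_upto_depth b_exp[where m = "Suc n"])
    qed
    show "(\<lambda>f j. f j - apow (rot (f j))) \<in> stab_sections (Suc n) \<rightarrow> UNIV \<rightarrow> stab_upto_depth (Suc n)"
      by (auto simp: stab_sections_def stab_upto_depth_def diff_apow_in_upto_depth)
    show "(\<lambda>j. ?F h j - apow (rot (?F h j))) = h" if "h \<in> UNIV \<rightarrow> stab_upto_depth (Suc n)" for h
    proof
      fix j
      have "rot (h j) = 0"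
        using that by (auto simp: stab_upto_depth_def)
      then show "?F h j - apow (rot (?F h j)) = h j"
        by simp
    qed
    show "?F (\<lambda>j. f j - apow (rot (f j))) = f" if "f \<in> stab_sections (Suc n)" for f
    proof
      fix j
      have f: "f i \<in> upto_depth (Suc n)" "rot (f i) = circ_conv (\<lambda>i. b_exp (f i)) i" for i
        using that by (auto simp: stab_sections_def)
      have "b_exp (f i - apow s) = b_exp (f i)" for i s
        using b_exp[OF f(1)[of i], of "- s"] by (simp add: apow_uminus)
      then show "?F (\<lambda>j. f j - apow (rot (f j))) j = f j"
        by (simp add: f(2)[symmetric])
    qed
  qed
  from bij_betw_same_card[OF this] show ?thesis
    by (simp add: PiE_UNIV_domain[symmetric] card_PiE)
qed

definition sols :: "('p mod_ring \<Rightarrow> 'p mod_ring) set" where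
  "sols = {v. \<forall>j. circ_conv v j * v j = 0}"

lemma nuc_normal_form: "g \<in> nuc \<Longrightarrow> g = apow (rot g) + bpow (b_exp g) \<and> rot g * b_exp g = 0"
  by (erule nuc_cases) simp_all

lemma normal_form_in_nuc: "s * t = 0 \<Longrightarrow> apow s + bpow t \<in> nuc"
  by auto

text \<open>An element of the nucleus is determined by its rotation and its exponent of b, and the
  product of these vanishes. With the rotations given by convolution, this is the circulant
  system.\<close>

lemma card_stab_sections_0: "card (stab_sections 0) = card sols"
proof -
  let ?F = "\<lambda>v j. apow (circ_conv v j) + bpow (v j)"
  have b_exp: "b_exp (apow s + bpow t) = t" for s t
    by (simp add: b_exp_add G.intros)
  have "bij_betw ?F sols (stab_sections 0)"
  proof (rule bij_betwI[where g = "\<lambda>f j. b_exp (f j)"])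
    show "?F \<in> sols \<rightarrow> stab_sections 0"
      by (auto simp: sols_def stab_sections_def upto_depth_0 b_exp intro: normal_form_in_nuc simp del: mult_eq_0_iff)
    show "(\<lambda>f j. b_exp (f j)) \<in> stab_sections 0 \<rightarrow> sols"
    proof
      fix f assume "f \<in> stab_sections 0"
      then have "f j \<in> nuc" "rot (f j) = circ_conv (\<lambda>i. b_exp (f i)) j" for j
        by (auto simp: stab_sections_def upto_depth_0)
      then show "(\<lambda>j. b_exp (f j)) \<in> sols"
        using nuc_normal_form by (simp add: sols_def del: mult_eq_0_iff) metis
    qed
    show "(\<lambda>j. b_exp (?F v j)) = v" for v
      by (simp add: b_exp)
    show "?F (\<lambda>j. b_exp (f j)) = f" if "f \<in> stab_sections 0" for f
    proof
      fix j
      have "f j \<in> nuc" "rot (f j) = circ_conv (\<lambda>i. b_exp (f i)) j"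
        using that by (auto simp: stab_sections_def upto_depth_0)
      then show "?F (\<lambda>j. b_exp (f j)) j = f j"
        using nuc_normal_form by metis
    qed
  qed
  from bij_betw_same_card[OF this] show ?thesis
    by simp
qed

lemma circ_conv_scale: "circ_conv (\<lambda>i. s * v i) j = s * circ_conv v j"
  by (simp add: circ_conv_def sum_distrib_left mult.assoc)

text \<open>The system is homogeneous, so scaling by \<open>s\<close> carries the solutions with sum
  1 to those with sum \<open>s\<close>.\<close>

lemma card_sols_scale:
  assumes "s \<noteq> 0"
  shows "card {v \<in> sols. sum v UNIV = s} = card {v \<in> sols. sum v UNIV = 1}"
proof -
  have "bij_betw (\<lambda>v i. s * v i) {v \<in> sols. sum v UNIV = 1} {v \<in> sols. sum v UNIV = s}"
    using assms
    by (intro bij_betwI[where g = "\<lambda>v i. inverse s * v i"])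
       (auto simp: sols_def circ_conv_scale sum_distrib_left[symmetric])
  from bij_betw_same_card[OF this] show ?thesis
    by simp
qed

lemma card_sols:
  "card sols = card {v \<in> sols. sum v UNIV = 0} + (CARD('p) - 1) * card {v \<in> sols. sum v UNIV = 1}"
proof -
  let ?S = "\<lambda>s. {v \<in> sols. sum v UNIV = s}"
  have "sols = (\<Union>s. ?S s)"
    by auto
  also have "card \<dots> = (\<Sum>s\<in>UNIV. card (?S s))"
    by (rule card_UN_disjoint) auto
  also have "\<dots> = card (?S 0) + (\<Sum>s\<in>UNIV - {0}. card (?S s))"
    by (rule sum.remove) simp_all
  also have "(\<Sum>s\<in>UNIV - {0}. card (?S s)) = (\<Sum>s\<in>UNIV - {0 :: 'p mod_ring}. card (?S 1))"
    by (rule sum.cong) (auto intro: card_sols_scale)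
  finally show ?thesis
    by (simp add: card_Diff_singleton)
qed

lemma card_stab_upto_depth: "card (stab_upto_depth (Suc n)) = card sols ^ (CARD('p) ^ n)"
proof (induction n)
  case 0
  show ?case by (simp only: card_stab_upto_depth_Suc card_stab_sections_0) simp
next
  case (Suc n)
  have "card (stab_upto_depth (Suc (Suc n))) = card (stab_upto_depth (Suc n)) ^ CARD('p)"
    by (simp only: card_stab_upto_depth_Suc[of "Suc n"] card_stab_sections_Suc)
  then show ?case
    by (simp add: Suc power_mult[symmetric] mult.commute)
qed

end


section \<open>Transfer to maps on words\<close>

text \<open>The field element \<open>0\<close> becomes the letter 1, at which b repeats
  itself.\<close>

definition letter :: "'p::prime_card mod_ring \<Rightarrow> nat" where
  "letter k = Suc (nat (to_int_mod_ring k))"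

definition letter_pos :: "nat \<Rightarrow> 'p::prime_card mod_ring" where
  "letter_pos x = of_nat (x - 1)"

lemma to_int_bounds: "0 \<le> to_int_mod_ring (k :: 'p::prime_card mod_ring)"
    "to_int_mod_ring k < int CARD('p)"
  using range_to_int_mod_ring[where 'a = 'p] by (auto simp: set_eq_iff image_iff)

lemma of_nat_to_int [simp]: "of_nat (nat (to_int_mod_ring k)) = (k :: 'p::prime_card mod_ring)"
  using to_int_bounds(1)[of k] by (simp add: of_nat_of_int_mod_ring)

lemma to_int_of_nat: "nat (to_int_mod_ring (of_nat n :: 'p::prime_card mod_ring)) = n mod CARD('p)"
proof -
  have "of_nat n = (of_nat (n mod CARD('p)) :: 'p mod_ring)"
    using of_nat_mod_CHAR[where 'a = "'p mod_ring", of n] by simp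
  moreover have "to_int_mod_ring (of_nat (n mod CARD('p)) :: 'p mod_ring) = int (n mod CARD('p))"
    unfolding of_nat_of_int_mod_ring o_def by (rule to_int_mod_ring_of_int_mod_ring) simp_all
  ultimately show ?thesis by simp
qed

lemma letter_pos_letter [simp]: "letter_pos (letter k) = k"
  by (simp add: letter_pos_def letter_def)

lemma letter_letter_pos [simp]: "x \<in> {1..CARD('p)} \<Longrightarrow> letter (letter_pos x :: 'p::prime_card mod_ring) = x"
  unfolding letter_pos_def letter_def to_int_of_nat by auto

lemma letter_range: "letter (k :: 'p::prime_card mod_ring) \<in> {1..CARD('p)}"
  using to_int_bounds[of k] by (auto simp: letter_def)

lemma inj_letter: "inj letter"
  by (metis letter_pos_letter injI)

lemma map_letter_pos_letter [simp]: "map letter_pos (map letter w) = w"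
  by (simp add: comp_def)

lemma map_letter_in_words [simp]: "map letter (w :: 'p::prime_card mod_ring list) \<in> words CARD('p)"
  using letter_range[where 'p = 'p] by (auto simp: words_def simp del: atLeastAtMost_iff)

lemma map_letter_letter_pos [simp]:
  "w \<in> words CARD('p) \<Longrightarrow> map letter (map letter_pos w :: 'p::prime_card mod_ring list) = w"
  by (auto simp: words_def in_lists_conv_set intro!: map_idI)

lemma words_cases:
  assumes "w \<in> words CARD('p)"
  obtains v :: "'p::prime_card mod_ring list" where "w = map letter v"
  using map_letter_letter_pos[OF assms] by metis

lemma act_zero [simp]: "act 0 w = w"
  by (induction w) simp_all

lemma act_plus: "act (g + h) w = act h (act g w)"
  by (induction w arbitrary: g h) (simp_all add: add.assoc)

text \<open>Faithfulness: the word \<open>[0]\<close> reveals the rotation, and words with first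
  letter \<open>k\<close> reveal the action of the section at \<open>k\<close>.\<close>

lemma lab_eq_of_act_eq:
  assumes "\<And>w. act g w = act h w" shows "lab g w = lab h w"
  using assms
proof (induction w arbitrary: g h)
  case Nil
  from Nil[of "[0]"] show ?case by (simp add: lab_Nil)
next
  case (Cons k w)
  have "act (sec k g) v = act (sec k h) v" for v
    using Cons.prems[of "k # v"] by simp
  then have "lab (sec k g) w = lab (sec k h) w"
    by (rule Cons.IH)
  then show ?case
    by (simp only: lab_Cons)
qed

lemma act_eqD:
  assumes "\<And>w. act g w = act h w" shows "g = h"
  by (intro raut.expand ext lab_eq_of_act_eq assms)

fun sec_word :: "'k list \<Rightarrow> 'k raut \<Rightarrow> 'k raut" where
  "sec_word [] g = g"
| "sec_word (k # u) g = sec_word u (sec k g)"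

lemma length_act [simp]: "length (act g w) = length w"
  by (induction w arbitrary: g) simp_all

lemma act_append: "act g (u @ w) = act g u @ act (sec_word u g) w"
  by (induction u arbitrary: g) simp_all

lemma sec_word_append: "sec_word (u @ w) g = sec_word w (sec_word u g)"
  by (induction u arbitrary: g) simp_all

definition tau :: "'p::prime_card mod_ring raut \<Rightarrow> tree_map" where
  "tau g w = (if w \<in> words CARD('p) then map letter (act g (map letter_pos w)) else w)"

lemma tau_map_letter: "tau g (map letter w) = map letter (act g w)"
  using map_letter_in_words[of w] unfolding tau_def by (simp only: map_letter_pos_letter if_True)

lemma tau_off: "w \<notin> words CARD('p) \<Longrightarrow> tau (g :: 'p::prime_card mod_ring raut) w = w"
  by (simp add: tau_def)

lemma tau_plus: "tau (g + h) = tau h \<circ> tau (g :: 'p::prime_card mod_ring raut)"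
proof
  fix w show "tau (g + h) w = (tau h \<circ> tau g) w"
  proof (cases "w \<in> words CARD('p)")
    case True
    then obtain v :: "'p mod_ring list" where "w = map letter v" by (rule words_cases)
    then show ?thesis by (simp only: tau_map_letter act_plus comp_apply)
  qed (simp add: tau_off)
qed

lemma tau_zero: "tau (0 :: 'p::prime_card mod_ring raut) = id"
proof
  fix w show "tau (0 :: 'p mod_ring raut) w = id w"
  proof (cases "w \<in> words CARD('p)")
    case True
    then obtain v :: "'p mod_ring list" where "w = map letter v" by (rule words_cases)
    then show ?thesis by (simp only: tau_map_letter act_zero id_apply)
  qed (simp add: tau_off)
qed

lemma tau_uminus: "tau (- g) \<circ> tau g = id" "tau g \<circ> tau (- g) = id"
  using tau_plus[of g "- g"] tau_plus[of "- g" g] by (simp_all add: tau_zero)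

lemma inj_tau: "inj tau"
proof (rule injI)
  fix g h :: "'p::prime_card mod_ring raut" assume eq: "tau g = tau h"
  have "act g w = act h w" for w
    using fun_cong[OF eq, of "map letter w"] unfolding tau_map_letter
    by (simp only: inj_map_eq_map[OF inj_letter])
  then show "g = h" by (rule act_eqD)
qed

lemma tau_eq_iff [simp]: "tau g = tau h \<longleftrightarrow> g = h"
  using inj_tau by (auto dest: injD)

lemma section_at_tau:
  "section_at CARD('p) (tau (g :: 'p::prime_card mod_ring raut)) (map letter u) = tau (sec_word u g)"
proof
  fix w
  show "section_at CARD('p) (tau g) (map letter u) w = tau (sec_word u g) w"
  proof (cases "w \<in> words CARD('p)")
    case True
    then obtain v :: "'p mod_ring list" where v: "w = map letter v" by (rule words_cases)
    have "tau g (map letter u @ map letter v) = map letter (act g u) @ map letter (act (sec_word u g) v)"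
      using tau_map_letter[of g "u @ v"] by (simp add: act_append)
    then show ?thesis
      using True unfolding v section_at_def tau_map_letter by simp
  qed (simp add: tau_off section_at_def)
qed

text \<open>Adjacency is expressed through the parent map \<open>butlast\<close>, which commutes
  with the action.\<close>

lemma tree_edge_words:
  assumes "u \<in> words d" "v \<in> words d"
  shows "tree_edge d u v \<longleftrightarrow> (v \<noteq> [] \<and> butlast v = u) \<or> (u \<noteq> [] \<and> butlast u = v)"
proof
  assume "tree_edge d u v"
  then show "(v \<noteq> [] \<and> butlast v = u) \<or> (u \<noteq> [] \<and> butlast u = v)"
    by (auto simp: tree_edge_def)
next
  assume "(v \<noteq> [] \<and> butlast v = u) \<or> (u \<noteq> [] \<and> butlast u = v)"
  then consider "v = u @ [last v]" "v \<noteq> []" | "u = v @ [last u]" "u \<noteq> []"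
    by (metis append_butlast_last_id)
  then show "tree_edge d u v"
    using assms last_in_set[of u] last_in_set[of v]
    by cases (auto simp: tree_edge_def words_def in_lists_conv_set)
qed

lemma act_butlast: "act g (butlast w) = butlast (act g w)"
proof (cases w rule: rev_cases)
  case (snoc u k)
  then show ?thesis by (simp add: act_append)
qed simp

lemma tau_in_words: "w \<in> words CARD('p) \<Longrightarrow> tau (g :: 'p::prime_card mod_ring raut) w \<in> words CARD('p)"
  unfolding tau_def using map_letter_in_words by simp

lemma tau_in_tree_auts: "tau (g :: 'p::prime_card mod_ring raut) \<in> tree_auts CARD('p)"
proof -
  let ?W = "words CARD('p)"
  have inv: "tau (- h) (tau h w) = w" for w and h :: "'p mod_ring raut"
    using fun_cong[OF tau_uminus(1), of h w] by simp
  have bij: "bij_betw (tau g) ?W ?W"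
    by (rule bij_betwI[where g = "tau (- g)"])
       (use inv[of g] inv[of "- g"] tau_in_words in auto)
  have perm: "tau g permutes ?W"
    by (rule bij_imp_permutes[OF bij]) (simp add: tau_off)
  have nil: "tau g [] = []"
    using tau_map_letter[of g "[]"] by simp
  have edge: "tree_edge CARD('p) (tau g u) (tau g v) \<longleftrightarrow> tree_edge CARD('p) u v"
    if uv: "u \<in> ?W" "v \<in> ?W" for u v
  proof -
    obtain u' :: "'p mod_ring list" where u': "u = map letter u'"
      using uv(1) by (rule words_cases)
    obtain v' :: "'p mod_ring list" where v': "v = map letter v'"
      using uv(2) by (rule words_cases)
    have eq: "map letter (act g x) = map letter (act g y) \<longleftrightarrow> map letter x = map letter y" for x y
      unfolding tau_map_letter[symmetric] by (metis inv)
    have "act g x = [] \<longleftrightarrow> x = []" for x :: "'p mod_ring list"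
      by (metis length_act length_0_conv)
    then show ?thesis
      unfolding tree_edge_words[OF uv] tree_edge_words[OF tau_in_words[OF uv(1)] tau_in_words[OF uv(2)]]
      unfolding u' v' tau_map_letter map_butlast[symmetric] act_butlast[symmetric] eq
      by simp
  qed
  show ?thesis
    using perm nil edge by (simp add: tree_auts_def)
qed

lemma m_inv_tau: "inv\<^bsub>Aut_tree CARD('p)\<^esub> (tau (g :: 'p::prime_card mod_ring raut)) = tau (- g)"
  unfolding m_inv_def
proof (rule the_equality)
  show "tau (- g) \<in> carrier (Aut_tree CARD('p)) \<and>
      tau g \<otimes>\<^bsub>Aut_tree CARD('p)\<^esub> tau (- g) = \<one>\<^bsub>Aut_tree CARD('p)\<^esub> \<and>
      tau (- g) \<otimes>\<^bsub>Aut_tree CARD('p)\<^esub> tau g = \<one>\<^bsub>Aut_tree CARD('p)\<^esub>"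
    by (simp add: Aut_tree_def tau_in_tree_auts tau_uminus)
next
  fix y
  assume "y \<in> carrier (Aut_tree CARD('p)) \<and>
      tau g \<otimes>\<^bsub>Aut_tree CARD('p)\<^esub> y = \<one>\<^bsub>Aut_tree CARD('p)\<^esub> \<and>
      y \<otimes>\<^bsub>Aut_tree CARD('p)\<^esub> tau g = \<one>\<^bsub>Aut_tree CARD('p)\<^esub>"
  then have "y \<circ> tau g = id"
    by (simp add: Aut_tree_def)
  then have "y \<circ> (tau g \<circ> tau (- g)) = tau (- g)"
    by (simp add: comp_assoc[symmetric])
  then show "y = tau (- g)"
    by (simp add: tau_uminus)
qed

lemma letter_add_1:
  "letter (k + 1 :: 'p::prime_card mod_ring) = (if letter k = CARD('p) then 1 else Suc (letter k))"
proof -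
  define n where "n = nat (to_int_mod_ring k)"
  have k: "k = of_nat n"
    by (simp add: n_def)
  have n: "n < CARD('p)"
    using to_int_bounds[of k] by (simp add: n_def)
  have "k + 1 = of_nat (Suc n)"
    by (simp add: k)
  then have "letter (k + 1) = Suc (Suc n mod CARD('p))"
    unfolding letter_def by (simp only: to_int_of_nat)
  moreover have "letter k = Suc n"
    by (simp add: letter_def n_def)
  ultimately show ?thesis
    using n by auto
qed

lemma tau_apow_1: "tau (apow (1 :: 'p::prime_card mod_ring)) = ggs_a CARD('p)"
proof
  fix w show "tau (apow (1 :: 'p mod_ring)) w = ggs_a CARD('p) w"
  proof (cases "w \<in> words CARD('p)")
    case True
    then obtain v :: "'p mod_ring list" where v: "w = map letter v" by (rule words_cases)
    show ?thesis
    proof (cases v)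
      case Nil
      then show ?thesis unfolding v tau_map_letter by (simp add: ggs_a_def)
    next
      case (Cons k u)
      then show ?thesis
        using True unfolding v tau_map_letter by (simp add: ggs_a_def letter_add_1)
    qed
  qed (simp add: tau_off ggs_a_def)
qed

lemma ggs_a_pow:
  "ggs_a CARD('p) [^]\<^bsub>Aut_tree CARD('p)\<^esub> (n :: nat) = tau (apow (of_nat n :: 'p::prime_card mod_ring))"
proof (induction n)
  case 0
  then show ?case by (simp add: nat_pow_def Aut_tree_def tau_zero)
next
  case (Suc n)
  have "ggs_a CARD('p) [^]\<^bsub>Aut_tree CARD('p)\<^esub> Suc n
      = ggs_a CARD('p) \<circ> ggs_a CARD('p) [^]\<^bsub>Aut_tree CARD('p)\<^esub> n"
    by (simp add: nat_pow_def Aut_tree_def)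
  also have "\<dots> = tau (apow (of_nat n) + apow (1 :: 'p mod_ring))"
    by (simp add: Suc tau_plus tau_apow_1)
  finally show ?case
    by (simp add: apow_add[symmetric] add.commute)
qed


section \<open>Uniqueness of portraits and the defining vector over the field\<close>

inductive_cases is_portrait_LeafE: "is_portrait d M g (Leaf h)"
inductive_cases is_portrait_NodeE: "is_portrait d M g (Node r ps)"

lemma is_portrait_unique:
  "is_portrait d M g P \<Longrightarrow> is_portrait d M g Q \<Longrightarrow> P = Q"
proof (induction arbitrary: Q rule: is_portrait.induct)
  case (leaf g)
  from leaf.prems leaf.hyps show ?case by cases simp_all
next
  case (node g ps)
  from node.prems obtain qs where qs: "Q = Node (root_perm g) qs"
    "list_all2 (is_portrait d M) (map (\<lambda>i. section_at d g [i]) [1..<Suc d]) qs"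
    using node.hyps(1) by cases auto
  have "ps = qs"
  proof (rule nth_equalityI)
    show len: "length ps = length qs"
      using node.IH qs(2) by (auto dest!: list_all2_lengthD)
    fix i assume "i < length ps"
    then show "ps ! i = qs ! i"
      using list_all2_nthD2[OF node.IH, of i] list_all2_nthD2[OF qs(2), of i] len by auto
  qed
  then show ?case by (simp add: qs(1))
qed

definition field_vec :: "(nat \<Rightarrow> 'p mod_ring) \<Rightarrow> 'p::prime_card mod_ring \<Rightarrow> 'p mod_ring" where
  "field_vec e k = (if k = 0 then 0 else e (nat (to_int_mod_ring k)))"

lemma field_vec_of_nat:
  "field_vec e (of_nat n :: 'p::prime_card mod_ring) =
    (if n mod CARD('p) = 0 then 0 else e (n mod CARD('p)))"
proof -
  have "(of_nat n = (0 :: 'p mod_ring)) \<longleftrightarrow> n mod CARD('p) = 0"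
    using of_nat_0_mod_ring_dvd[of n, where 'a = 'p] of_nat_mod_CHAR[where 'a = "'p mod_ring", of n]
    by (auto simp: mod_eq_0_iff_dvd)
  then show ?thesis
    by (simp add: field_vec_def to_int_of_nat)
qed

locale ggs_tree =
  fixes e :: "nat \<Rightarrow> 'p::prime_card mod_ring"
  assumes nonsymmetric: "\<not> symmetric_vector CARD('p) e"
begin

sublocale ggs "field_vec e"
proof
  show "field_vec e 0 = 0"
    by (simp add: field_vec_def)
  obtain i where i: "i \<in> {1..CARD('p) - 1}" "e i \<noteq> e (CARD('p) - i)"
    using nonsymmetric by (auto simp: symmetric_vector_def)
  then have m: "i mod CARD('p) = i" "(CARD('p) - i) mod CARD('p) = CARD('p) - i"
    by auto
  have "of_nat (CARD('p) - i) = (- of_nat i :: 'p mod_ring)"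
    using i(1) by (auto simp: of_nat_diff)
  then have "field_vec e (- of_nat i) = e (CARD('p) - i)"
    using field_vec_of_nat[of e "CARD('p) - i"] unfolding m using i(1) by auto
  moreover have "field_vec e (of_nat i) = e i"
    using field_vec_of_nat[of e i] unfolding m using i(1) by auto
  ultimately show "\<exists>i. field_vec e i \<noteq> field_vec e (- i)"
    using i(2) by metis
qed

lemma tau_bpow_1: "tau (bpow 1) = ggs_b CARD('p) e"
proof
  fix w
  have "map letter (act (bpow 1) v) = ggs_b CARD('p) e (map letter v)" for v
  proof (induction v)
    case (Cons k v)
    show ?case
    proof (cases "k = 0")
      case True
      then show ?thesis using Cons by (simp add: sec_bpow letter_def)
    next
      case False
      define n where "n = nat (to_int_mod_ring k)"
      have k: "k = of_nat n" by (simp add: n_def)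
      then have n: "n \<noteq> 0" using False by (auto intro: ccontr)
      have letter: "letter k = Suc n" by (simp add: letter_def n_def)
      have e: "field_vec e k = e n" using False by (simp add: field_vec_def n_def)
      have range: "Suc n \<in> {2..CARD('p)}"
        using letter_range[of k] n letter by simp
      have "ggs_b CARD('p) e (map letter (k # v)) = Suc n # tau (apow (e n)) (map letter v)"
        using range n by (simp add: letter ggs_a_pow)
      also have "\<dots> = map letter (act (bpow 1) (k # v))"
        using False by (simp add: sec_bpow letter e tau_map_letter)
      finally show ?thesis by simp
    qed
  qed simp
  note * = this
  \<comment> \<open>\<open>ggs_b\<close> also recurses through lists that are not vertices; there
    either the head is out of range or the tail is not a vertex.\<close>
  have off: "w \<notin> words CARD('p) \<Longrightarrow> ggs_b CARD('p) e w = w" for w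
  proof (induction w)
    case (Cons x w)
    show ?case
    proof (cases "x \<in> {1..CARD('p)}")
      case True
      then have "w \<notin> words CARD('p)"
        using Cons.prems by (auto simp: words_def)
      then show ?thesis
        using Cons.IH by (simp add: ggs_a_pow tau_off)
    next
      case False
      then show ?thesis by auto
    qed
  qed simp
  show "tau (bpow 1) w = ggs_b CARD('p) e w"
  proof (cases "w \<in> words CARD('p)")
    case True
    then obtain v :: "'p mod_ring list" where "w = map letter v" by (rule words_cases)
    then show ?thesis using * by (simp only: tau_map_letter)
  qed (simp add: tau_off off)
qed

lemma GGS_eq: "GGS CARD('p) e = tau ` G"
proof
  show "GGS CARD('p) e \<subseteq> tau ` G"
  proof
    fix x assume "x \<in> GGS CARD('p) e"
    then show "x \<in> tau ` G"
      unfolding GGS_def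
    proof (induction rule: generate.induct)
      case one
      have one_eq: "\<one>\<^bsub>Aut_tree CARD('p)\<^esub> = tau (0 :: 'p mod_ring raut)"
        unfolding tau_zero by (simp add: Aut_tree_def)
      show ?case
        unfolding one_eq by (rule imageI) simp
    next
      case (incl h)
      then show ?case
        using G.apow G.bpow by (auto simp: tau_apow_1[symmetric] tau_bpow_1[symmetric])
    next
      case (inv h)
      then obtain g where "g \<in> G" "h = tau g"
        using G.apow G.bpow by (auto simp: tau_apow_1[symmetric] tau_bpow_1[symmetric])
      then show ?case
        using G_uminus by (auto simp: m_inv_tau)
    next
      case (eng h k)
      then obtain g g' where "g \<in> G" "h = tau g" "g' \<in> G" "k = tau g'" by blast
      moreover have "h \<otimes>\<^bsub>Aut_tree CARD('p)\<^esub> k = tau (g + g')"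
        by (simp add: Aut_tree_def tau_plus calculation)
      ultimately show ?case using G.add by simp
    qed
  qed
  have gen_one: "tau (0 :: 'p mod_ring raut) \<in> GGS CARD('p) e"
    using generate.one[of "Aut_tree CARD('p)"] by (simp add: GGS_def Aut_tree_def tau_zero)
  have gen_add: "tau (g + h) \<in> GGS CARD('p) e"
    if "tau g \<in> GGS CARD('p) e" "tau h \<in> GGS CARD('p) e" for g h :: "'p mod_ring raut"
    using generate.eng[OF that[unfolded GGS_def]]
    by (simp add: GGS_def Aut_tree_def tau_plus)
  have a: "tau (apow (1 :: 'p mod_ring)) \<in> GGS CARD('p) e"
    unfolding tau_apow_1 GGS_def by (rule generate.incl) simp
  have b: "tau (bpow 1) \<in> GGS CARD('p) e"
    unfolding tau_bpow_1 GGS_def by (rule generate.incl) simp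
  \<comment> \<open>Every field element is the image of a natural number, so iterated products of
    the two generators give all their powers.\<close>
  have an: "tau (apow (of_nat n :: 'p mod_ring)) \<in> GGS CARD('p) e" for n
    by (induction n) (simp_all add: gen_one apow_add gen_add a)
  have bn: "tau (bpow (of_nat n)) \<in> GGS CARD('p) e" for n
    by (induction n) (simp_all add: gen_one bpow_add gen_add b)
  have "tau g \<in> GGS CARD('p) e" if "g \<in> G" for g
    using that
  proof (induction rule: G.induct)
    case (apow s)
    then show ?case using an of_nat_surj_mod_ring[of s] by auto
  next
    case (bpow s)
    then show ?case using bn of_nat_surj_mod_ring[of s] by auto
  next
    case (add g h)
    then show ?case by (simp add: gen_add)
  qed
  then show "tau ` G \<subseteq> GGS CARD('p) e"
    by blast
qed

section \<open>The nucleus and portrait depth\<close>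

lemma sec_word_in_nuc: "depth_at_most n g \<Longrightarrow> n \<le> length u \<Longrightarrow> sec_word u g \<in> nuc"
proof (induction n arbitrary: g u)
  case 0
  then show ?case
    by (induction u arbitrary: g) (simp_all add: sec_in_nuc)
next
  case (Suc n)
  then show ?case by (cases u) simp_all
qed

lemma contracting_set_nuc: "contracting_set CARD('p) (tau ` G) (tau ` nuc)"
  unfolding contracting_set_def
proof (intro conjI ballI)
  show "finite (tau ` nuc)"
    by (simp add: nuc_def)
  show "tau ` nuc \<subseteq> tau ` G"
    using nuc_subset_G by blast
  fix x assume "x \<in> tau ` G"
  then obtain g where g: "g \<in> G" "x = tau g" by blast
  obtain n where n: "depth_at_most n g"
    using G_depth_at_most[OF g(1)] by blast
  have "section_at CARD('p) x u \<in> tau ` nuc" if u: "u \<in> words CARD('p)" "n \<le> length u" for u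
  proof -
    obtain v :: "'p mod_ring list" where v: "u = map letter v"
      using u(1) by (rule words_cases)
    then show ?thesis
      using sec_word_in_nuc[OF n, of v] u(2) by (simp add: g(2) section_at_tau)
  qed
  then show "\<exists>n. \<forall>u\<in>words CARD('p). n \<le> length u \<longrightarrow> section_at CARD('p) x u \<in> tau ` nuc"
    by blast
qed

lemma sec_word_replicate_bpow: "sec_word (replicate n 0) (bpow s) = bpow s"
  by (induction n) (simp_all add: sec_bpow)

text \<open>A power of b recurs at every vertex 0...0, and one further letter \<open>i\<close> with
  non-zero entry yields any power of a. So each element of \<open>nuc\<close> occurs as a section
  arbitrarily far down.\<close>

lemma nuc_subset_contracting_set:
  assumes "contracting_set CARD('p) (tau ` G) M" shows "tau ` nuc \<subseteq> M"
proof -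
  have ev: "\<exists>n. \<forall>u. n \<le> length u \<longrightarrow> tau (sec_word u g) \<in> M" if g: "g \<in> G" for g
  proof -
    obtain n where n: "\<forall>u\<in>words CARD('p). n \<le> length u \<longrightarrow> section_at CARD('p) (tau g) u \<in> M"
      using assms g unfolding contracting_set_def by blast
    have "tau (sec_word u g) \<in> M" if "n \<le> length u" for u
      using n[rule_format, OF map_letter_in_words[of u]] that by (simp add: section_at_tau)
    then show ?thesis by blast
  qed
  have b: "tau (bpow s) \<in> M" for s
  proof -
    obtain n where "\<forall>u. n \<le> length u \<longrightarrow> tau (sec_word u (bpow s)) \<in> M"
      using ev[OF G.bpow] by blast
    from this[rule_format, of "replicate n 0"] show ?thesis
      by (simp add: sec_word_replicate_bpow)
  qed
  have a: "tau (apow s) \<in> M" for s :: "'p mod_ring"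
  proof -
    obtain i where i: "field_vec e i \<noteq> 0" "i \<noteq> 0"
      by (rule e_nonzero)
    let ?b = "bpow (s / field_vec e i)"
    obtain n where "\<forall>u. n \<le> length u \<longrightarrow> tau (sec_word u ?b) \<in> M"
      using ev[OF G.bpow] by blast
    from this[rule_format, of "replicate n 0 @ [i]"] show ?thesis
      using i by (simp add: sec_word_append sec_word_replicate_bpow sec_bpow)
  qed
  show ?thesis
    using a b by (auto simp: nuc_def)
qed

lemma nucleus_eq: "nucleus CARD('p) (tau ` G) = tau ` nuc"
  unfolding nucleus_def
  by (rule Least_equality) (rule contracting_set_nuc, erule nuc_subset_contracting_set)

lemma tau_in_nuc_iff: "tau g \<in> tau ` nuc \<longleftrightarrow> g \<in> nuc"
  by auto

lemma sections_eq:
  fixes g :: "'p mod_ring raut"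
  shows "map (\<lambda>i. section_at CARD('p) (tau g) [i]) [1..<Suc CARD('p)]
    = map (\<lambda>i. tau (sec (letter_pos i) g)) [1..<Suc CARD('p)]"
proof (rule map_cong[OF refl])
  fix i assume "i \<in> set [1..<Suc CARD('p)]"
  then have "i \<in> {1..CARD('p)}"
    by auto
  then have "[i] = map letter [letter_pos i :: 'p mod_ring]"
    by (simp only: letter_letter_pos list.map)
  then show "section_at CARD('p) (tau g) [i] = tau (sec (letter_pos i) g)"
    by (simp only: section_at_tau sec_word.simps)
qed

lemma ex_portrait: "depth_at_most n g \<Longrightarrow> \<exists>P. is_portrait CARD('p) (tau ` nuc) (tau g) P"
proof (induction n arbitrary: g)
  case 0
  then show ?case by (auto intro: is_portrait.leaf)
next
  case (Suc n)
  show ?case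
  proof (cases "g \<in> nuc")
    case True
    then show ?thesis by (auto intro: is_portrait.leaf)
  next
    case False
    have "\<forall>k. \<exists>P. is_portrait CARD('p) (tau ` nuc) (tau (sec k g)) P"
      using Suc by simp
    then obtain P where P: "\<And>k. is_portrait CARD('p) (tau ` nuc) (tau (sec k g)) (P k)"
      by metis
    have "list_all2 (is_portrait CARD('p) (tau ` nuc))
        (map (\<lambda>i. section_at CARD('p) (tau g) [i]) [1..<Suc CARD('p)])
        (map (\<lambda>i. P (letter_pos i)) [1..<Suc CARD('p)])"
      unfolding sections_eq by (simp add: list_all2_conv_all_nth P del: upt_Suc)
    then show ?thesis
      using is_portrait.node tau_in_nuc_iff False by blast
  qed
qed

lemma height_le_iff:
  "is_portrait CARD('p) (tau ` nuc) (tau g) P \<Longrightarrow> height P \<le> n \<longleftrightarrow> depth_at_most n g"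
proof (induction n arbitrary: g P)
  case 0
  then show ?case by cases (simp_all add: tau_in_nuc_iff)
next
  case (Suc n)
  from Suc.prems show ?case
  proof cases
    case leaf
    then have "depth_at_most 0 g" by (simp add: tau_in_nuc_iff)
    then show ?thesis
      using leaf depth_at_most_mono[of 0 "Suc n" g] by (simp del: depth_at_most.simps)
  next
    case (node ps)
    let ?is = "[1..<Suc CARD('p)]"
    have len: "length ps = length ?is"
      using node(3) by (auto dest: list_all2_lengthD)
    have *: "is_portrait CARD('p) (tau ` nuc) (tau (sec (letter_pos (?is ! j)) g)) (ps ! j)"
      if "j < length ps" for j
      using list_all2_nthD2[OF node(3)[unfolded sections_eq], of j] that len
      by (simp del: upt_Suc)
    \<comment> \<open>The bound on \<open>Max\<close> in \<open>height\<close> splits over the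
      children only for a non-empty list.\<close>
    have "ps \<noteq> []"
      using len by auto
    then have "height P \<le> Suc n \<longleftrightarrow> (\<forall>j<length ps. height (ps ! j) \<le> n)"
      by (auto simp: node(1) all_set_conv_all_nth)
    also have "\<dots> \<longleftrightarrow> (\<forall>j<length ps. depth_at_most n (sec (letter_pos (?is ! j)) g))"
      using Suc.IH[OF *] by blast
    also have "\<dots> \<longleftrightarrow> (\<forall>i\<in>set ?is. depth_at_most n (sec (letter_pos i) g))"
      unfolding all_set_conv_all_nth len ..
    also have "\<dots> \<longleftrightarrow> (\<forall>k. depth_at_most n (sec k g))"
    proof
      assume all: "\<forall>i\<in>set ?is. depth_at_most n (sec (letter_pos i) g)"
      show "\<forall>k. depth_at_most n (sec k g)"
      proof
        fix k :: "'p mod_ring"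
        have "letter k \<in> set ?is"
          using letter_range[of k] by (auto simp del: upt_Suc)
        from all[rule_format, OF this] show "depth_at_most n (sec k g)"
          by simp
      qed
    qed blast
    finally show ?thesis by simp
  qed
qed

lemma depth_le_iff:
  assumes "g \<in> G" shows "depth CARD('p) (tau ` G) (tau g) \<le> n \<longleftrightarrow> depth_at_most n g"
proof -
  obtain m where "depth_at_most m g"
    using G_depth_at_most[OF assms] by blast
  then obtain P where P: "is_portrait CARD('p) (tau ` nuc) (tau g) P"
    using ex_portrait by blast
  then have "nucleus_portrait CARD('p) (tau ` G) (tau g) = P"
    unfolding nucleus_portrait_def nucleus_eq using is_portrait_unique by blast
  then show ?thesis
    using height_le_iff[OF P] by (simp add: depth_def)
qed

lemma portrait_growth_eq: "portrait_growth CARD('p) (GGS CARD('p) e) n = card (upto_depth n)"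
proof -
  have "{x \<in> tau ` G. depth CARD('p) (tau ` G) x \<le> n} = tau ` upto_depth n"
    using depth_le_iff by (auto simp: upto_depth_def)
  then show ?thesis
    unfolding portrait_growth_def GGS_eq
    by (simp add: card_image inj_on_subset[OF inj_tau])
qed

section \<open>The circulant system in matrix form\<close>

lemma bij_of_nat: "bij_betw of_nat {..<CARD('p)} (UNIV :: 'p mod_ring set)"
  by (rule bij_betwI[where g = "\<lambda>k. nat (to_int_mod_ring k)"])
     (use to_int_bounds[where 'p = 'p] in \<open>auto simp: to_int_of_nat nat_less_iff\<close>)

lemma sum_of_nat: "(\<Sum>i<CARD('p). f (of_nat i)) = (\<Sum>k\<in>(UNIV :: 'p mod_ring set). f k)"
  by (rule sum.reindex_bij_betw[OF bij_of_nat])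

lemma circulant_mult_vec:
  assumes "j < CARD('p)"
  shows "(transpose_mat (C0 CARD('p) e) *\<^sub>v vec CARD('p) (\<lambda>i. v (of_nat i))) $ j = circ_conv v (of_nat j)"
proof -
  have "(transpose_mat (C0 CARD('p) e) *\<^sub>v vec CARD('p) (\<lambda>i. v (of_nat i))) $ j
      = (\<Sum>i<CARD('p). C0 CARD('p) e $$ (i, j) * v (of_nat i))"
    using assms by (simp add: C0_def circulant_def scalar_prod_def lessThan_atLeast0)
  also have "\<dots> = (\<Sum>i<CARD('p). v (of_nat i) * field_vec e (of_nat j - of_nat i))"
  proof (rule sum.cong[OF refl])
    fix i assume i: "i \<in> {..<CARD('p)}"
    \<comment> \<open>The summand \<open>CARD('p)\<close> vanishes in the field and keeps the
      subtraction of natural numbers exact, as in \<open>circulant\<close>.\<close>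
    then have eq: "of_nat j - of_nat i = (of_nat (CARD('p) + j - i) :: 'p mod_ring)"
      by (simp add: of_nat_diff)
    have "field_vec e (of_nat j - of_nat i) = C0 CARD('p) e $$ (i, j)"
      unfolding eq field_vec_of_nat using i assms by (simp add: C0_def circulant_def)
    then show "C0 CARD('p) e $$ (i, j) * v (of_nat i)
        = v (of_nat i) * field_vec e (of_nat j - of_nat i)"
      by (simp add: mult.commute)
  qed
  also have "\<dots> = circ_conv v (of_nat j)"
    unfolding circ_conv_def by (rule sum_of_nat)
  finally show ?thesis .
qed

lemma card_solutions: "card (solutions CARD('p) e s) = card {v \<in> sols. sum v UNIV = s}"
proof -
  let ?vec = "\<lambda>v :: 'p mod_ring \<Rightarrow> 'p mod_ring. vec CARD('p) (\<lambda>i. v (of_nat i))"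
  have iff: "?vec v \<in> solutions CARD('p) e s \<longleftrightarrow> v \<in> {v \<in> sols. sum v UNIV = s}" for v
  proof -
    have "(transpose_mat (C0 CARD('p) e) *\<^sub>v ?vec v) \<odot>\<^sub>v ?vec v = 0\<^sub>v CARD('p)
        \<longleftrightarrow> (\<forall>j<CARD('p). circ_conv v (of_nat j) * v (of_nat j) = 0)"
      by (auto simp: coord_prod_def vec_eq_iff circulant_mult_vec simp del: mult_eq_0_iff)
    also have "\<dots> \<longleftrightarrow> (\<forall>k\<in>of_nat ` {..<CARD('p)}. circ_conv v k * v k = 0)"
      by blast
    also have "\<dots> \<longleftrightarrow> v \<in> sols"
      unfolding bij_betw_imp_surj_on[OF bij_of_nat] by (simp add: sols_def)
    finally show ?thesis
      by (simp add: solutions_def sum_of_nat)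
  qed
  have "bij_betw ?vec {v \<in> sols. sum v UNIV = s} (solutions CARD('p) e s)"
  proof (rule bij_betwI[where g = "\<lambda>w k. w $ nat (to_int_mod_ring k)"])
    show "?vec \<in> {v \<in> sols. sum v UNIV = s} \<rightarrow> solutions CARD('p) e s"
      using iff by blast
    have inv: "?vec (\<lambda>k. w $ nat (to_int_mod_ring k)) = w" if "w \<in> solutions CARD('p) e s" for w
      using that by (auto simp: solutions_def vec_eq_iff to_int_of_nat)
    then show "?vec (\<lambda>k. w $ nat (to_int_mod_ring k)) = w" if "w \<in> solutions CARD('p) e s" for w
      using that .
    show "(\<lambda>w k. w $ nat (to_int_mod_ring k)) \<in> solutions CARD('p) e s \<rightarrow> {v \<in> sols. sum v UNIV = s}"
    proof
      fix w assume "w \<in> solutions CARD('p) e s"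
      then have "?vec (\<lambda>k. w $ nat (to_int_mod_ring k)) \<in> solutions CARD('p) e s"
        by (simp only: inv)
      then show "(\<lambda>k. w $ nat (to_int_mod_ring k)) \<in> {v \<in> sols. sum v UNIV = s}"
        by (rule iff[of "\<lambda>k. w $ nat (to_int_mod_ring k)", THEN iffD1])
    qed
    show "(\<lambda>k. ?vec v $ nat (to_int_mod_ring k)) = v" for v
      using to_int_bounds[where 'p = 'p] by (simp add: nat_less_iff)
  qed
  from bij_betw_same_card[OF this] show ?thesis
    by simp
qed

end

theorem theorem1p2:
  fixes p :: nat and e :: "nat \<Rightarrow> 'p::prime_card mod_ring" and x\<^sub>1 y\<^sub>1 :: nat
  assumes "p = CARD('p)" and "p \<ge> 3"
    and "\<not> symmetric_vector p e"
    and "x\<^sub>1 = card (solutions p e 0)"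
    and "y\<^sub>1 = card (solutions p e 1)"
  shows "portrait_growth p (GGS p e) 0 = 1 + 2 * (p - 1) \<and>
    (\<forall>n\<ge>1. portrait_growth p (GGS p e) n = p * (x\<^sub>1 + (p - 1) * y\<^sub>1) ^ (p ^ (n - 1)))"
proof -
  interpret ggs_tree e
    using assms(1,3) by unfold_locales simp
  have "portrait_growth p (GGS p e) n = p * (x\<^sub>1 + (p - 1) * y\<^sub>1) ^ (p ^ (n - 1))" if "n \<ge> 1" for n
  proof -
    obtain m where "n = Suc m"
      using \<open>n \<ge> 1\<close> by (cases n) simp_all
    then show ?thesis
      unfolding assms(1,4,5) portrait_growth_eq
      by (simp add: card_upto_depth_Suc card_stab_upto_depth card_sols card_solutions)
  qed
  then show ?thesis
    unfolding assms(1) portrait_growth_eq card_upto_depth_0 by simp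
qed

end
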